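(* Let $F(X,Y)$ be a binary form with complex coefficients of degree $n\ge 3$ and discriminant $D_F\neq 0$. Let $A_F$ denote the area of the region $\{(x,y)\in\mathbb{R}^2: |F(x,y)|\le 1\}$. Then $$|D_F|^{1/n(n-1)}A_F\le 3B\!\left(\tfrac13,\tfrac13\right),$$ where $B$ is the Beta function. Equality holds if and only if $F$ is a cubic form which, up to multiplication by a non-zero complex number, is equivalent under $\mathrm{GL}_2(\mathbb{R})$ to the form $XY(X-Y)$.
   Context: Every binary form of degree $n$ with complex coefficients factors as $F(X,Y)=\prod_{i=1}^n(\alpha_iX-\beta_iY)$ with $\alpha_i,\beta_i\in\mathbb{C}$, and its discriminant is $D_F=\prod_{i<j}(\alpha_i\beta_j-\alpha_j\beta_i)^2$. For $T=\begin{pmatrix}a&b\\c&d\end{pmatrix}\in\mathrm{GL}_2(\mathbb{R})$ (the group of $2\times 2$ real invertible matrices), $F_T(X,Y)=F(aX+bY,cX+dY)$; forms $F,G$ are equivalent under $\mathrm{GL}_2(\mathbb{R})$ if $G=F_T$ for some $T\in\mathrm{GL}_2(\mathbb{R})$. *)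

theory Defs
  imports
    "HOL-Analysis.Analysis"
    "HOL-Computational_Algebra.Fundamental_Theorem_Algebra"
begin

section \<open>Binary forms\<close>

text \<open>A complex binary form is represented by the polynomial function that it induces on pairs of
  complex numbers; as the complex numbers are infinite, this determines its coefficients.\<close>

definition binary_form :: "nat \<Rightarrow> (complex \<Rightarrow> complex \<Rightarrow> complex) \<Rightarrow> bool" where
  "binary_form n F \<longleftrightarrow>
     (\<exists>c :: nat \<Rightarrow> complex. \<forall>X Y. F X Y = (\<Sum>k\<le>n. c k * X ^ k * Y ^ (n - k)))"

definition is_factorization ::
    "nat \<Rightarrow> (complex \<Rightarrow> complex \<Rightarrow> complex) \<Rightarrow> (nat \<Rightarrow> complex) \<Rightarrow> (nat \<Rightarrow> complex) \<Rightarrow> bool" where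
  "is_factorization n F \<alpha> \<beta> \<longleftrightarrow> (\<forall>X Y. F X Y = (\<Prod>i<n. \<alpha> i * X - \<beta> i * Y))"

text \<open>For \<open>n \<ge> 1\<close> the description below determines a unique number for every form of degree \<open>n\<close>:
  see \<open>binary_form_factorization\<close> (existence of a factorization) and \<open>discriminant_eq\<close>
  (independence of its choice).\<close>

definition discriminant :: "nat \<Rightarrow> (complex \<Rightarrow> complex \<Rightarrow> complex) \<Rightarrow> complex" where
  "discriminant n F = (THE D. \<exists>\<alpha> \<beta>. is_factorization n F \<alpha> \<beta> \<and>
     D = (\<Prod>(i, j)\<in>{(i, j). i < j \<and> j < n}. (\<alpha> i * \<beta> j - \<alpha> j * \<beta> i)\<^sup>2))"

definition subst_form ::
    "(complex \<Rightarrow> complex \<Rightarrow> complex) \<Rightarrow> real^2^2 \<Rightarrow> complex \<Rightarrow> complex \<Rightarrow> complex" where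
  "subst_form F T = (\<lambda>X Y. F (of_real (T $ 1 $ 1) * X + of_real (T $ 1 $ 2) * Y)
                             (of_real (T $ 2 $ 1) * X + of_real (T $ 2 $ 2) * Y))"

definition GL2R_equivalent ::
    "(complex \<Rightarrow> complex \<Rightarrow> complex) \<Rightarrow> (complex \<Rightarrow> complex \<Rightarrow> complex) \<Rightarrow> bool" where
  "GL2R_equivalent F G \<longleftrightarrow> (\<exists>T :: real^2^2. invertible T \<and> G = subst_form F T)"

text \<open>The area is taken in \<open>[0, \<infinity>]\<close>, so that bounding it includes the claim that it is finite.\<close>

definition form_area :: "(complex \<Rightarrow> complex \<Rightarrow> complex) \<Rightarrow> ennreal" where
  "form_area F =
     emeasure lborel {(x :: real, y :: real). cmod (F (of_real x) (of_real y)) \<le> 1}"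


section \<open>Well-definedness of the discriminant\<close>

lemma binary_form_split:
  assumes "binary_form (Suc n) F"
  shows "\<exists>a b G. binary_form n G \<and> (\<forall>X Y. F X Y = (a * X - b * Y) * G X Y)"
proof -
  obtain c :: "nat \<Rightarrow> complex"
    where c: "\<And>X Y. F X Y = (\<Sum>k\<le>Suc n. c k * X ^ k * Y ^ (Suc n - k))"
    using assms unfolding binary_form_def by blast
  show ?thesis
  proof (cases "c (Suc n) = 0")
    case True
    define G where "G = (\<lambda>X Y. \<Sum>k\<le>n. c k * X ^ k * Y ^ (n - k))"
    have "F X Y = (0 * X - (-1) * Y) * G X Y" for X Y
      unfolding c G_def using True by (simp add: sum_distrib_left Suc_diff_le mult_ac)
    moreover have "binary_form n G"
      unfolding binary_form_def G_def by blast
    ultimately show ?thesis by blast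
  next
    case False
    define p where "p = (\<Sum>k\<le>Suc n. monom (c k) k)"
    have cp: "coeff p k = (if k \<le> Suc n then c k else 0)" for k
      unfolding p_def by (simp add: coeff_sum del: sum.atMost_Suc)
    have "\<not> constant (poly p)"
    proof
      assume "constant (poly p)"
      hence "degree p = 0" by (simp add: constant_degree)
      hence "coeff p (Suc n) = 0" by (simp add: coeff_eq_0)
      thus False using False cp by simp
    qed
    then obtain r where "poly p r = 0"
      using fundamental_theorem_of_algebra by blast
    then obtain q where q: "p = [:- r, 1:] * q"
      by (auto simp: poly_eq_0_iff_dvd dvd_def)
    have q0: "q \<noteq> 0"
      using False cp[of "Suc n"] q by auto
    have "degree p \<le> Suc n"
      by (rule degree_le) (simp add: cp)
    hence "degree q \<le> n"
      using q q0 by (simp add: degree_mult_eq del: mult_pCons_left)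
    hence qn: "coeff q (Suc n) = 0"
      by (simp add: coeff_eq_0)
    define G where "G = (\<lambda>X Y. \<Sum>k\<le>n. coeff q k * X ^ k * Y ^ (n - k))"
    have ck: "c k = (case k of 0 \<Rightarrow> 0 | Suc j \<Rightarrow> coeff q j) - r * coeff q k" if "k \<le> Suc n" for k
      using that cp[of k] by (simp add: q coeff_pCons split: nat.splits)
    have "F X Y = (1 * X - r * Y) * G X Y" for X Y
    proof -
      have "F X Y = (\<Sum>k\<le>Suc n. (case k of 0 \<Rightarrow> 0 | Suc j \<Rightarrow> coeff q j) * X ^ k * Y ^ (Suc n - k))
                  - (\<Sum>k\<le>Suc n. r * coeff q k * X ^ k * Y ^ (Suc n - k))"
        unfolding c sum_subtractf[symmetric]
        by (intro sum.cong) (auto simp: ck algebra_simps)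
      also have "(\<Sum>k\<le>Suc n. (case k of 0 \<Rightarrow> 0 | Suc j \<Rightarrow> coeff q j) * X ^ k * Y ^ (Suc n - k))
               = X * G X Y"
        unfolding G_def sum.atMost_Suc_shift by (simp add: sum_distrib_left mult_ac)
      also have "(\<Sum>k\<le>Suc n. r * coeff q k * X ^ k * Y ^ (Suc n - k)) = r * Y * G X Y"
        unfolding G_def by (simp add: qn sum_distrib_left Suc_diff_le mult_ac)
      finally show ?thesis by (simp add: algebra_simps)
    qed
    moreover have "binary_form n G"
      unfolding binary_form_def G_def by blast
    ultimately show ?thesis by blast
  qed
qed

theorem binary_form_factorization:
  assumes "binary_form n F" "n \<ge> 1"
  shows "\<exists>\<alpha> \<beta>. is_factorization n F \<alpha> \<beta>"
  using assms(2,1)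
proof (induction n arbitrary: F rule: nat_induct_at_least)
  case base
  then obtain c :: "nat \<Rightarrow> complex"
    where "\<And>X Y. F X Y = (\<Sum>k\<le>1. c k * X ^ k * Y ^ (1 - k))"
    unfolding binary_form_def by blast
  hence "is_factorization 1 F (\<lambda>_. c 1) (\<lambda>_. - c 0)"
    unfolding is_factorization_def by simp
  thus ?case by blast
next
  case (Suc n)
  from binary_form_split[OF Suc.prems] obtain a b G
    where G: "binary_form n G" and F: "\<And>X Y. F X Y = (a * X - b * Y) * G X Y" by blast
  obtain \<alpha> \<beta> where "is_factorization n G \<alpha> \<beta>"
    using Suc.IH[OF G] by blast
  hence "is_factorization (Suc n) F (\<alpha>(n := a)) (\<beta>(n := b))"
    unfolding is_factorization_def F by (simp add: mult.commute)
  thus ?case by blast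
qed

definition pair_prod :: "nat set \<Rightarrow> (nat \<Rightarrow> complex) \<Rightarrow> (nat \<Rightarrow> complex) \<Rightarrow> complex" where
  "pair_prod I \<alpha> \<beta> =
     (\<Prod>(i, j)\<in>{(i, j). i \<in> I \<and> j \<in> I \<and> i < j}. (\<alpha> i * \<beta> j - \<alpha> j * \<beta> i)\<^sup>2)"

lemma pair_prod_remove:
  assumes "finite I" "k \<in> I"
  shows "pair_prod I \<alpha> \<beta> =
    pair_prod (I - {k}) \<alpha> \<beta> * (\<Prod>i\<in>I - {k}. \<alpha> i * \<beta> k - \<beta> i * \<alpha> k)\<^sup>2"
proof -
  define g where "g = (\<lambda>i j. (\<alpha> i * \<beta> j - \<alpha> j * \<beta> i)\<^sup>2)"
  have g_sym: "g i j = g j i" for i j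
    unfolding g_def by (simp add: power2_eq_square algebra_simps)
  let ?P = "\<lambda>I. {(i, j). i \<in> I \<and> j \<in> I \<and> i < j}"
  let ?L = "{i \<in> I. i < k}" and ?U = "{i \<in> I. k < i}"
  have fin: "finite (?P J)" if "finite J" for J :: "nat set"
    by (rule finite_subset[of _ "J \<times> J"]) (use that in auto)
  have eq: "?P I = ?P (I - {k}) \<union> ((\<lambda>i. (i, k)) ` ?L \<union> (\<lambda>i. (k, i)) ` ?U)"
    using assms by auto
  have "(\<Prod>(i, j)\<in>?P I. g i j) =
      (\<Prod>(i, j)\<in>?P (I - {k}). g i j) *
      (\<Prod>(i, j)\<in>(\<lambda>i. (i, k)) ` ?L \<union> (\<lambda>i. (k, i)) ` ?U. g i j)"
    unfolding eq by (rule prod.union_disjoint) (use assms fin[of "I - {k}"] in auto)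
  also have "(\<Prod>(i, j)\<in>(\<lambda>i. (i, k)) ` ?L \<union> (\<lambda>i. (k, i)) ` ?U. g i j) =
      (\<Prod>(i, j)\<in>(\<lambda>i. (i, k)) ` ?L. g i j) * (\<Prod>(i, j)\<in>(\<lambda>i. (k, i)) ` ?U. g i j)"
    by (rule prod.union_disjoint) (use assms in auto)
  also have "(\<Prod>(i, j)\<in>(\<lambda>i. (i, k)) ` ?L. g i j) = (\<Prod>i\<in>?L. g i k)"
    by (subst prod.reindex) (auto simp: inj_on_def)
  also have "(\<Prod>(i, j)\<in>(\<lambda>i. (k, i)) ` ?U. g i j) = (\<Prod>i\<in>?U. g i k)"
    by (subst prod.reindex) (auto simp: inj_on_def g_sym)
  also have "(\<Prod>i\<in>?L. g i k) * (\<Prod>i\<in>?U. g i k) = (\<Prod>i\<in>?L \<union> ?U. g i k)"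
    by (rule prod.union_disjoint[symmetric]) (use assms in auto)
  also have "?L \<union> ?U = I - {k}" by auto
  also have "(\<Prod>i\<in>I - {k}. g i k) = (\<Prod>i\<in>I - {k}. \<alpha> i * \<beta> k - \<beta> i * \<alpha> k)\<^sup>2"
    unfolding g_def prod_power_distrib by (simp add: mult.commute)
  finally show ?thesis
    unfolding pair_prod_def g_def .
qed

lemma linear_prod_eq_0D:
  fixes \<alpha> \<beta> :: "nat \<Rightarrow> complex"
  assumes "finite I" "\<And>X Y. (\<Prod>i\<in>I. \<alpha> i * X - \<beta> i * Y) = 0"
  shows "\<exists>i\<in>I. \<alpha> i = 0 \<and> \<beta> i = 0"
proof -
  have "poly (\<Prod>i\<in>I. [:\<alpha> i, - \<beta> i:]) t = poly 0 t" for t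
    using assms(2)[of 1 t] by (simp add: poly_prod mult.commute)
  hence "(\<Prod>i\<in>I. [:\<alpha> i, - \<beta> i:]) = 0"
    using poly_eq_poly_eq_iff by blast
  thus ?thesis using assms(1) by auto
qed

lemma pair_prod_eq_0:
  assumes "finite I" "k \<in> I" "\<alpha> k = 0" "\<beta> k = 0" "card I \<ge> 2"
  shows "pair_prod I \<alpha> \<beta> = 0"
proof -
  have "I - {k} \<noteq> {}"
    using assms by (metis One_nat_def Suc_1 card.empty card_Suc_Diff1 not_less_eq_eq le_refl)
  thus ?thesis
    using assms by (subst pair_prod_remove[of I k]) auto
qed

lemma pair_prod_small:
  assumes "finite I" "card I \<le> 1"
  shows "pair_prod I \<alpha> \<beta> = 1"
proof -
  have "{(i, j). i \<in> I \<and> j \<in> I \<and> i < j} = {}"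
    using assms card_le_Suc0_iff_eq[of I] by auto
  thus ?thesis unfolding pair_prod_def by (simp only: prod.empty)
qed

lemma linear_cancel:
  fixes a b :: complex
  assumes ab: "a \<noteq> 0 \<or> b \<noteq> 0" and "finite I" "finite J"
    and eq: "\<And>X Y. (a * X - b * Y) * (\<Prod>i\<in>I. \<alpha> i * X - \<beta> i * Y) =
                    (a * X - b * Y) * (c * (\<Prod>i\<in>J. \<gamma> i * X - \<delta> i * Y))"
  shows "(\<Prod>i\<in>I. \<alpha> i * X - \<beta> i * Y) = c * (\<Prod>i\<in>J. \<gamma> i * X - \<delta> i * Y)"
proof (cases "a * X - b * Y = 0")
  case False
  thus ?thesis using eq[of X Y] by simp
next
  case True
  define u v where "u = cnj a" and "v = - cnj b"
  have uv: "a * u - b * v \<noteq> 0"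
  proof -
    have "a * u - b * v = of_real ((cmod a)\<^sup>2 + (cmod b)\<^sup>2)"
      unfolding u_def v_def by (simp add: complex_norm_square del: of_real_power)
    moreover have "(cmod a)\<^sup>2 + (cmod b)\<^sup>2 \<noteq> 0"
      using ab by simp
    ultimately show ?thesis by (metis of_real_eq_0_iff)
  qed
  define f where "f = (\<lambda>t. \<Prod>i\<in>I. \<alpha> i * (X + t * u) - \<beta> i * (Y + t * v))"
  define g where "g = (\<lambda>t. c * (\<Prod>i\<in>J. \<gamma> i * (X + t * u) - \<delta> i * (Y + t * v)))"
  have "isCont f 0" "isCont g 0"
    unfolding f_def g_def by (intro continuous_intros)+
  hence fg: "f \<midarrow>0\<rightarrow> f 0" "g \<midarrow>0\<rightarrow> g 0"
    by (simp_all add: isCont_def)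
  have "f t = g t" if "t \<noteq> 0" for t
  proof -
    have "a * (X + t * u) - b * (Y + t * v) = (a * X - b * Y) + t * (a * u - b * v)"
      by (simp add: algebra_simps)
    also have "\<dots> \<noteq> 0" using True that uv by simp
    finally show ?thesis
      using eq[of "X + t * u" "Y + t * v"] unfolding f_def g_def by simp
  qed
  hence "g \<midarrow>0\<rightarrow> f 0"
    using fg(1) by (subst LIM_equal[of 0 g f]) auto
  hence "f 0 = g 0" using fg(2) LIM_unique by blast
  thus ?thesis unfolding f_def g_def by simp
qed

lemma pair_prod_unique:
  assumes "finite I" "finite J" "card I = n" "card J = n" "c \<noteq> 0"
    and "\<And>X Y. (\<Prod>i\<in>I. \<alpha> i * X - \<beta> i * Y) = c * (\<Prod>i\<in>J. \<gamma> i * X - \<delta> i * Y)"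
  shows "c\<^sup>2 * pair_prod I \<alpha> \<beta> = c ^ (2 * n) * pair_prod J \<gamma> \<delta>"
  using assms
proof (induction n arbitrary: I J c)
  case 0
  have "I = {}" "J = {}" using 0 by auto
  moreover have "c = 1" using 0(6)[of 0 0] calculation by simp
  ultimately show ?case by (simp add: pair_prod_def)
next
  case (Suc n I J c)
  show ?case
  proof (cases "\<exists>k\<in>I. \<alpha> k = 0 \<and> \<beta> k = 0")
    case True
    then obtain k where k: "k \<in> I" "\<alpha> k = 0" "\<beta> k = 0" by blast
    have "(\<Prod>i\<in>I. \<alpha> i * X - \<beta> i * Y) = 0" for X Y
      using k Suc.prems(1) by (auto intro!: prod_zero bexI[of _ k])
    hence "(\<Prod>i\<in>J. \<gamma> i * X - \<delta> i * Y) = 0" for X Y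
      using Suc.prems(5) Suc.prems(6)[of X Y] by (metis mult_eq_0_iff)
    then obtain l where l: "l \<in> J" "\<gamma> l = 0" "\<delta> l = 0"
      using linear_prod_eq_0D[OF Suc.prems(2)] by blast
    show ?thesis
    proof (cases "n = 0")
      case True
      thus ?thesis using Suc.prems by (simp add: pair_prod_small power2_eq_square)
    next
      case False
      hence "card I \<ge> 2" "card J \<ge> 2" using Suc.prems by auto
      hence "pair_prod I \<alpha> \<beta> = 0" "pair_prod J \<gamma> \<delta> = 0"
        using pair_prod_eq_0 k l Suc.prems(1,2) by auto
      thus ?thesis by simp
    qed
  next
    case nz: False
    have "I \<noteq> {}" using Suc.prems by auto
    then obtain k where k: "k \<in> I" by blast
    have kz: "\<alpha> k \<noteq> 0 \<or> \<beta> k \<noteq> 0" using nz k by blast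
    have "(\<Prod>i\<in>I. \<alpha> i * \<beta> k - \<beta> i * \<alpha> k) = 0"
      using k Suc.prems(1) by (auto intro!: prod_zero bexI[of _ k])
    hence "(\<Prod>i\<in>J. \<gamma> i * \<beta> k - \<delta> i * \<alpha> k) = 0"
      using Suc.prems(5) unfolding Suc.prems(6) by (simp only: mult_eq_0_iff) simp
    then obtain l where l: "l \<in> J" and l0: "\<gamma> l * \<beta> k - \<delta> l * \<alpha> k = 0"
      using Suc.prems(2) by auto
    have "\<exists>a. \<gamma> l = a * \<alpha> k \<and> \<delta> l = a * \<beta> k"
    proof (cases "\<alpha> k = 0")
      case True
      thus ?thesis using kz l0 by (intro exI[of _ "\<delta> l / \<beta> k"]) auto
    next
      case False
      thus ?thesis using l0 by (intro exI[of _ "\<gamma> l / \<alpha> k"]) (auto simp: field_simps)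
    qed
    then obtain a where a: "\<gamma> l = a * \<alpha> k" "\<delta> l = a * \<beta> k" by blast
    have a0: "a \<noteq> 0"
    proof
      assume "a = 0"
      hence "(\<Prod>i\<in>J. \<gamma> i * X - \<delta> i * Y) = 0" for X Y
        using l a Suc.prems(2) by (auto intro!: prod_zero bexI[of _ l])
      hence "(\<Prod>i\<in>I. \<alpha> i * X - \<beta> i * Y) = 0" for X Y
        using Suc.prems(6) by simp
      thus False using linear_prod_eq_0D[OF Suc.prems(1)] nz by blast
    qed
    let ?I = "I - {k}" and ?J = "J - {l}"
    have main: "(\<Prod>i\<in>?I. \<alpha> i * X - \<beta> i * Y) = c * a * (\<Prod>i\<in>?J. \<gamma> i * X - \<delta> i * Y)" for X Y
    proof (rule linear_cancel[OF kz])
      fix X Y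
      have "(\<alpha> k * X - \<beta> k * Y) * (\<Prod>i\<in>?I. \<alpha> i * X - \<beta> i * Y) = (\<Prod>i\<in>I. \<alpha> i * X - \<beta> i * Y)"
        using prod.remove[OF Suc.prems(1) k, of "\<lambda>i. \<alpha> i * X - \<beta> i * Y"] by simp
      also have "\<dots> = c * ((\<gamma> l * X - \<delta> l * Y) * (\<Prod>i\<in>?J. \<gamma> i * X - \<delta> i * Y))"
        unfolding Suc.prems(6)
        using prod.remove[OF Suc.prems(2) l, of "\<lambda>i. \<gamma> i * X - \<delta> i * Y"] by simp
      also have "\<dots> = (\<alpha> k * X - \<beta> k * Y) * (c * a * (\<Prod>i\<in>?J. \<gamma> i * X - \<delta> i * Y))"
        unfolding a by (simp add: algebra_simps)
      finally show "(\<alpha> k * X - \<beta> k * Y) * (\<Prod>i\<in>?I. \<alpha> i * X - \<beta> i * Y) =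
        (\<alpha> k * X - \<beta> k * Y) * (c * a * (\<Prod>i\<in>?J. \<gamma> i * X - \<delta> i * Y))" .
    qed (use Suc.prems in auto)
    have cards: "card ?I = n" "card ?J = n" using Suc.prems k l by auto
    have IH: "(c * a)\<^sup>2 * pair_prod ?I \<alpha> \<beta> = (c * a) ^ (2 * n) * pair_prod ?J \<gamma> \<delta>"
      by (rule Suc.IH) (use Suc.prems cards main a0 in auto)
    define Q where "Q = (\<Prod>i\<in>?J. \<gamma> i * \<beta> k - \<delta> i * \<alpha> k)"
    have QJ: "(\<Prod>i\<in>?J. \<gamma> i * \<delta> l - \<delta> i * \<gamma> l) = a ^ n * Q"
    proof -
      have "(\<Prod>i\<in>?J. \<gamma> i * \<delta> l - \<delta> i * \<gamma> l) = (\<Prod>i\<in>?J. a * (\<gamma> i * \<beta> k - \<delta> i * \<alpha> k))"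
        unfolding a by (simp add: algebra_simps)
      thus ?thesis unfolding Q_def by (simp add: prod.distrib cards)
    qed
    have "c\<^sup>2 * pair_prod I \<alpha> \<beta> = c\<^sup>2 * (pair_prod ?I \<alpha> \<beta> * (c * a * Q)\<^sup>2)"
      using k Suc.prems(1) by (simp add: pair_prod_remove[of I k] main Q_def)
    also have "\<dots> = c\<^sup>2 * Q\<^sup>2 * ((c * a)\<^sup>2 * pair_prod ?I \<alpha> \<beta>)"
      by (simp add: power_mult_distrib mult_ac)
    also have "\<dots> = c\<^sup>2 * c ^ (2 * n) * (pair_prod ?J \<gamma> \<delta> * (a ^ n * Q)\<^sup>2)"
      unfolding IH by (simp add: power_mult_distrib power_mult[symmetric] mult_ac)
    also have "\<dots> = c ^ (2 * Suc n) * pair_prod J \<gamma> \<delta>"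
      unfolding pair_prod_remove[OF Suc.prems(2) l] QJ by (simp add: power2_eq_square mult_ac)
    finally show ?thesis .
  qed
qed

theorem discriminant_eq:
  assumes "is_factorization n F \<alpha> \<beta>"
  shows "discriminant n F =
    (\<Prod>(i, j)\<in>{(i, j). i < j \<and> j < n}. (\<alpha> i * \<beta> j - \<alpha> j * \<beta> i)\<^sup>2)"
proof -
  have pp: "(\<Prod>(i, j)\<in>{(i, j). i < j \<and> j < n}. (\<alpha> i * \<beta> j - \<alpha> j * \<beta> i)\<^sup>2) =
      pair_prod {..<n} \<alpha> \<beta>" for \<alpha> \<beta>
  proof -
    have "{(i, j). i < j \<and> j < n} = {(i, j). i \<in> {..<n} \<and> j \<in> {..<n} \<and> i < j}" by auto
    thus ?thesis unfolding pair_prod_def by simp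
  qed
  have uniq: "pair_prod {..<n} \<gamma> \<delta> = pair_prod {..<n} \<alpha> \<beta>" if "is_factorization n F \<gamma> \<delta>" for \<gamma> \<delta>
    using pair_prod_unique[of "{..<n}" "{..<n}" n 1 \<gamma> \<delta> \<alpha> \<beta>] assms that
    by (simp add: is_factorization_def)
  show ?thesis
    unfolding discriminant_def pp
    by (rule the_equality) (use assms uniq in blast)+
qed

end

theory Submission
  imports Defs "HOL-Probability.Probability"
begin

text \<open>Write \<open>F = L\<^sub>1 \<cdots> L\<^sub>n\<close>. In the coordinate \<open>t = x / y\<close> the normalised area is the integral over the
  line of a density, a product of powers of the determinants \<open>|det (L\<^sub>i, L\<^sub>j)|\<close> and of the
  \<open>|L\<^sub>i(t, 1)|\<close>.

  For cubic forms with real \<open>L\<^sub>i\<close> a linear change of variables leads to \<open>X Y (X - Y)\<close>, whose area is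
  \<open>3 B(1/3, 1/3)\<close>. For a complex form \<open>L\<close> with conjugate \<open>L'\<close>, all \<open>L + w L'\<close> with \<open>|w| = 1\<close> are
  proportional to real forms, and at a real point \<open>L + w L'\<close> has no zero in \<open>|w| < 1\<close>. Hence the density is
  (up to reflection of zeros) the modulus of a holomorphic function of \<open>w\<close>, its value at \<open>w = 0\<close> is at
  most its mean over the circle, and this is strict unless \<open>L\<close> is proportional to a real form. Replacing
  the three linear factors one by one bounds every cubic form by the real case.

  For \<open>n \<ge> 4\<close> the density of \<open>F\<close> is the geometric mean of the densities of the forms \<open>F / L\<^sub>k\<close>, so the
  inequality of arithmetic and geometric means gives the bound by induction on \<open>n\<close>. It is strict,
  as these densities have different poles.\<close>

section \<open>Means over the unit circle\<close>

text \<open>The obstacle to averaging over \<open>w\<close> is the negative power of |L_i(t)|. For a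
  general affine function of \<open>w\<close> the mean of the logarithm only dominates its value at
  0, which is the wrong direction for a negative exponent. At a real t, however, L_i and its
  conjugate have values of equal modulus, so for L_i + w L_i' the mean is exact, and only the
  determinants, whose exponent is positive, contribute an inequality. The density has degree 0 in
  each factor, so passing to a proportional real form changes nothing.

  Strictness comes from the point of the circle where the denominator vanishes: equality would force
  a determinant to vanish there too, and this happens only if L_i is proportional to a real form or
  another factor vanishes at t.

  From degree 4 on, a cubic subform with a nonreal factor already falls short of the bound. The
  comparison of poles settles the forms with real factors only, whose cubic subforms all attain it.

  The logarithmic means need no holomorphic functions; they follow from the invariance of the circle
  under rotations and squaring.\<close>

definition circle_measure :: "complex measure" where
  "circle_measure = distr (uniform_measure lborel {0..<2 * pi}) borel cis"

lemma measurable_cis [measurable]: "cis \<in> borel_measurable borel"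
  by (intro borel_measurable_continuous_onI continuous_intros)

lemma sets_circle_measure [simp, measurable_cong]: "sets circle_measure = sets borel"
  by (simp add: circle_measure_def)

lemma space_circle_measure [simp]: "space circle_measure = UNIV"
  by (simp add: circle_measure_def)

lemma prob_space_circle_measure: "prob_space circle_measure"
  unfolding circle_measure_def
  by (intro prob_space.prob_space_distr prob_space_uniform_measure) auto

lemma AE_circle_measure_iff:
  assumes [measurable]: "Measurable.pred borel P"
  shows "(AE w in circle_measure. P w) \<longleftrightarrow> (AE x in lborel. x \<in> {0..<2 * pi} \<longrightarrow> P (cis x))"
  unfolding circle_measure_def
  by (subst AE_distr_iff) (auto simp: AE_uniform_measure)

lemma AE_circle_measure_norm: "AE w in circle_measure. cmod w = 1"
  by (subst AE_circle_measure_iff) auto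

text \<open>This discards the zeros of affine functions of \<open>w\<close>, where
  \<open>ln 0 = 0\<close> and \<open>0 powr x = 0\<close> would break the identities used
  below.\<close>

lemma AE_circle_measure_neq: "AE w in circle_measure. w \<noteq> u"
proof (subst AE_circle_measure_iff)
  have "{x \<in> {0..<2 * pi}. cis x = u} \<subseteq> {Arg2pi u}"
    using Arg2pi_unique[of 1] by (auto simp: cis_conv_exp mult.commute)
  hence "countable {x \<in> {0..<2 * pi}. cis x = u}"
    by (rule countable_subset) simp
  hence "AE x in lborel. x \<notin> {x \<in> {0..<2 * pi}. cis x = u}"
    by (intro AE_not_in countable_imp_null_set_lborel)
  thus "AE x in lborel. x \<in> {0..<2 * pi} \<longrightarrow> cis x \<noteq> u"
    by eventually_elim auto
qed measurable

lemma nn_integral_circle_measure: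
  assumes [measurable]: "f \<in> borel_measurable borel"
  shows "(\<integral>\<^sup>+w. f w \<partial>circle_measure) =
    (\<integral>\<^sup>+x. f (cis x) * indicator {0..<2 * pi} x \<partial>lborel) / ennreal (2 * pi)"
  unfolding circle_measure_def
  by (subst nn_integral_distr) (auto simp: nn_integral_uniform_measure)

lemma nn_integral_cis_shift:
  fixes a b c :: real
  assumes [measurable]: "f \<in> borel_measurable borel"
  shows "(\<integral>\<^sup>+x. f (cis (c + x)) * indicator {a..<b} x \<partial>lborel) =
    (\<integral>\<^sup>+x. f (cis x) * indicator {c + a..<c + b} x \<partial>lborel)"
  by (subst (2) nn_integral_real_affine[where c = 1 and t = c])
     (auto intro!: nn_integral_cong split: split_indicator)

lemma nn_integral_cis_union:
  fixes a b c :: real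
  assumes "a \<le> b" "b \<le> c" and [measurable]: "f \<in> borel_measurable borel"
  shows "(\<integral>\<^sup>+x. f (cis x) * indicator {a..<c} x \<partial>lborel) =
    (\<integral>\<^sup>+x. f (cis x) * indicator {a..<b} x \<partial>lborel) + (\<integral>\<^sup>+x. f (cis x) * indicator {b..<c} x \<partial>lborel)"
  by (subst nn_integral_add[symmetric])
     (use assms in \<open>auto intro!: nn_integral_cong split: split_indicator\<close>)

lemma nn_integral_cis_period:
  assumes [measurable]: "f \<in> borel_measurable borel"
  shows "(\<integral>\<^sup>+x. f (cis x) * indicator {2 * pi + a..<2 * pi + b} x \<partial>lborel) =
    (\<integral>\<^sup>+x. f (cis x) * indicator {a..<b} x \<partial>lborel)"
proof -
  have "cis (2 * pi + x) = cis x" for x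
    by (simp flip: cis_mult)
  thus ?thesis using nn_integral_cis_shift[OF assms, of "2 * pi" a b] by simp
qed

lemma nn_integral_circle_measure_rotate:
  assumes "cmod u = 1" and [measurable]: "f \<in> borel_measurable borel"
  shows "(\<integral>\<^sup>+w. f (u * w) \<partial>circle_measure) = (\<integral>\<^sup>+w. f w \<partial>circle_measure)"
proof -
  define c where "c = Arg2pi u"
  have c: "0 \<le> c" "c \<le> 2 * pi"
    using Arg2pi[of u] by (auto simp: c_def)
  have u: "u = cis c"
    using Arg2pi_eq[of u] assms(1) by (metis c_def cis_conv_exp mult_1 of_real_1)
  let ?I = "\<lambda>a b. \<integral>\<^sup>+x. f (cis x) * indicator {a..<b} x \<partial>lborel"
  have "(\<integral>\<^sup>+x. f (u * cis x) * indicator {0..<2 * pi} x \<partial>lborel) = ?I (c + 0) (c + 2 * pi)"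
    unfolding u cis_mult by (rule nn_integral_cis_shift) simp
  also have "\<dots> = ?I c (2 * pi) + ?I (2 * pi + 0) (2 * pi + c)"
    using c by (subst nn_integral_cis_union[of _ "2 * pi"]) (auto simp: add.commute)
  also have "\<dots> = ?I 0 c + ?I c (2 * pi)"
    by (subst nn_integral_cis_period) (simp_all add: add.commute)
  also have "\<dots> = ?I 0 (2 * pi)"
    using c by (intro nn_integral_cis_union[symmetric]) auto
  finally show ?thesis
    by (simp add: nn_integral_circle_measure)
qed

text \<open>Squaring doubles the angle, so the circle is run through twice at double speed; the
  integral over an angle range of length 4 pi is computed once by periodicity and once by
  substitution.\<close>

lemma nn_integral_circle_measure_square:
  assumes [measurable]: "f \<in> borel_measurable borel"
  shows "(\<integral>\<^sup>+w. f (w\<^sup>2) \<partial>circle_measure) = (\<integral>\<^sup>+w. f w \<partial>circle_measure)"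
proof -
  let ?I = "\<lambda>a b. \<integral>\<^sup>+x. f (cis x) * indicator {a..<b} x \<partial>lborel"
  have "?I 0 (4 * pi) = ?I 0 (2 * pi) + ?I (2 * pi + 0) (2 * pi + 2 * pi)"
    by (subst nn_integral_cis_union[of _ "2 * pi"]) auto
  also have "\<dots> = ?I 0 (2 * pi) + ?I 0 (2 * pi)"
    by (subst nn_integral_cis_period) (rule assms refl)+
  also have "\<dots> = 2 * ?I 0 (2 * pi)"
    by (rule mult_2[symmetric])
  finally have "2 * ?I 0 (2 * pi) = ?I 0 (4 * pi)" ..
  also have "\<dots> = 2 * (\<integral>\<^sup>+x. f (cis (2 * x)) * indicator {0..<2 * pi} x \<partial>lborel)"
  proof -
    have ind: "indicator {0..<4 * pi} (2 * x) = (indicator {0..<2 * pi} x :: ennreal)" for x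
      by (simp split: split_indicator)
    show ?thesis
      by (subst nn_integral_real_affine[where c = 2 and t = 0]) (simp_all add: ind)
  qed
  finally have "?I 0 (2 * pi) = (\<integral>\<^sup>+x. f (cis (2 * x)) * indicator {0..<2 * pi} x \<partial>lborel)"
    by (simp add: ennreal_mult_cancel_left)
  thus ?thesis
    by (simp add: nn_integral_circle_measure power2_eq_square cis_mult)
qed

lemma distr_circle_measure_rotate:
  assumes "cmod u = 1"
  shows "distr circle_measure borel (\<lambda>w. u * w) = circle_measure"
proof (rule measure_eqI)
  fix A assume "A \<in> sets (distr circle_measure borel (\<lambda>w. u * w))"
  hence [measurable]: "A \<in> sets borel" by simp
  show "emeasure (distr circle_measure borel (\<lambda>w. u * w)) A = emeasure circle_measure A"
    using nn_integral_circle_measure_rotate[OF assms, of "indicator A"]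
    by (simp add: nn_integral_distr flip: nn_integral_indicator)
qed simp

lemma distr_circle_measure_square: "distr circle_measure borel (\<lambda>w. w\<^sup>2) = circle_measure"
proof (rule measure_eqI)
  fix A assume "A \<in> sets (distr circle_measure borel (\<lambda>w. w\<^sup>2))"
  hence [measurable]: "A \<in> sets borel" by simp
  show "emeasure (distr circle_measure borel (\<lambda>w. w\<^sup>2)) A = emeasure circle_measure A"
    using nn_integral_circle_measure_square[of "indicator A"]
    by (simp add: nn_integral_distr flip: nn_integral_indicator)
qed simp

text \<open>Jensen's inequality for \<open>exp\<close>. The tangent is taken at \<open>g0\<close>
  instead of at the mean, so a lower bound for the mean suffices; as the tangent touches only at
  \<open>g0\<close>, equality forces \<open>g\<close> to be constant almost everywhere. If
  \<open>exp (g x)\<close> is not integrable, the right-hand side is infinite.\<close>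

lemma (in prob_space) nn_integral_exp_ge:
  fixes g :: "'a \<Rightarrow> real"
  assumes g: "integrable M g" and g0: "g0 \<le> (\<integral>x. g x \<partial>M)"
  shows "ennreal (exp g0) \<le> (\<integral>\<^sup>+x. ennreal (exp (g x)) \<partial>M)"
    and "\<not> (AE x in M. g x = g0) \<Longrightarrow> ennreal (exp g0) < (\<integral>\<^sup>+x. ennreal (exp (g x)) \<partial>M)"
proof -
  have [measurable]: "g \<in> borel_measurable M" using g by auto
  \<comment> \<open>The tangent of \<open>exp\<close> at \<open>g0\<close>, evaluated at
    \<open>g x\<close>.\<close>
  define r where "r = (\<lambda>x. exp g0 * (1 + (g x - g0)))"
  have r: "integrable M r" "(\<integral>x. r x \<partial>M) = exp g0 * (1 + ((\<integral>x. g x \<partial>M) - g0))"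
    unfolding r_def using g by (auto simp: prob_space)
  have r_le: "r x \<le> exp (g x)" for x
  proof -
    have "exp g0 * (1 + (g x - g0)) \<le> exp g0 * exp (g x - g0)"
      by (intro mult_left_mono) auto
    thus ?thesis by (simp add: r_def flip: exp_add)
  qed
  have r_eq: "g x = g0" if "exp (g x) = r x" for x
  proof -
    have "exp g0 * exp (g x - g0) = exp g0 * (1 + (g x - g0))"
      using that by (simp add: r_def flip: exp_add)
    hence "exp (g x - g0) = 1 + (g x - g0)" by simp
    hence "ln (exp (g x - g0)) = exp (g x - g0) - 1" unfolding ln_exp by linarith
    hence "exp (g x - g0) = 1" by (intro ln_eq_minus_one) auto
    thus ?thesis by simp
  qed
  have int_r: "exp g0 \<le> (\<integral>x. r x \<partial>M)"
    unfolding r using g0 by simp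
  have *: "ennreal (exp g0) \<le> (\<integral>\<^sup>+x. ennreal (exp (g x)) \<partial>M) \<and>
     (\<not> (AE x in M. g x = g0) \<longrightarrow> ennreal (exp g0) < (\<integral>\<^sup>+x. ennreal (exp (g x)) \<partial>M))"
  proof (cases "integrable M (\<lambda>x. exp (g x))")
    case True
    have "(\<integral>x. r x \<partial>M) \<le> (\<integral>x. exp (g x) \<partial>M)"
      using r True by (intro integral_mono r_le)
    moreover have "(\<integral>x. r x \<partial>M) < (\<integral>x. exp (g x) \<partial>M)" if "\<not> (AE x in M. g x = g0)"
    proof (rule ccontr)
      assume "\<not> (\<integral>x. r x \<partial>M) < (\<integral>x. exp (g x) \<partial>M)"
      hence "(\<integral>x. exp (g x) - r x \<partial>M) = 0"
        using True r calculation by simp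
      hence "AE x in M. exp (g x) - r x = 0"
        using True r r_le by (subst (asm) integral_nonneg_eq_0_iff_AE) auto
      hence "AE x in M. g x = g0"
        by eventually_elim (use r_eq in auto)
      thus False using that by simp
    qed
    moreover have "(\<integral>\<^sup>+x. ennreal (exp (g x)) \<partial>M) = ennreal (\<integral>x. exp (g x) \<partial>M)"
      using True by (intro nn_integral_eq_integral) auto
    ultimately show ?thesis
      using int_r by (auto intro!: ennreal_leI simp: ennreal_less_iff)
  next
    case False
    hence "(\<integral>\<^sup>+x. ennreal (exp (g x)) \<partial>M) = \<infinity>"
      by (auto simp: integrable_iff_bounded less_top[symmetric])
    thus ?thesis by simp
  qed
  show "ennreal (exp g0) \<le> (\<integral>\<^sup>+x. ennreal (exp (g x)) \<partial>M)"
    and "\<not> (AE x in M. g x = g0) \<Longrightarrow> ennreal (exp g0) < (\<integral>\<^sup>+x. ennreal (exp (g x)) \<partial>M)"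
    using * by auto
qed

section \<open>Logarithmic means of affine functions over the circle\<close>

interpretation circle: prob_space circle_measure
  by (rule prob_space_circle_measure)

lemma one_plus_mult_neq_0:
  fixes u w :: complex
  assumes "u \<noteq> 0" "w \<noteq> - 1 / u"
  shows "1 + u * w \<noteq> 0"
proof
  assume "1 + u * w = 0"
  hence "w * u = - 1" by (simp add: add_eq_0_iff mult.commute)
  thus False using assms by (metis nonzero_eq_divide_eq)
qed

text \<open>With r = |u| the modulus lies in [1 - r, 1 + r], and ln (1 + r) \<le> r \<le> - ln (1 -
  r), so the lower end decides. The bound is uniform in \<open>w\<close> and increases with |u|, so
  it holds throughout a smaller disc, as the doubling argument requires.\<close>

lemma circle_ln_bound:
  assumes "cmod u < 1" "cmod w = 1"
  shows "\<bar>ln (cmod (1 + u * w))\<bar> \<le> - ln (1 - cmod u)"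
proof -
  let ?r = "cmod u" and ?y = "cmod (1 + u * w)"
  have y: "1 - ?r \<le> ?y" "?y \<le> 1 + ?r"
    using norm_triangle_ineq[of 1 "u * w"] norm_diff_ineq[of 1 "u * w"] assms(2)
    by (simp_all add: norm_mult)
  have "ln (1 - ?r) \<le> ln ?y"
    using y assms by (subst ln_le_cancel_iff) auto
  moreover have "ln ?y \<le> ?y - 1"
    using y assms by (intro ln_le_minus_one) auto
  moreover have "ln (1 - ?r) \<le> (1 - ?r) - 1"
    using assms by (intro ln_le_minus_one) auto
  ultimately show ?thesis using y by linarith
qed

lemma integrable_ln_circle_less:
  assumes "cmod u < 1"
  shows "integrable circle_measure (\<lambda>w. ln (cmod (1 + u * w)))"
proof (rule circle.integrable_const_bound)
  show "AE w in circle_measure. norm (ln (cmod (1 + u * w))) \<le> - ln (1 - cmod u)"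
    using AE_circle_measure_norm by eventually_elim (use circle_ln_bound[OF assms] in simp)
qed measurable

lemma integral_circle_rotate:
  fixes f :: "complex \<Rightarrow> real"
  assumes "cmod u = 1" and [measurable]: "f \<in> borel_measurable borel"
  shows "(\<integral>w. f (u * w) \<partial>circle_measure) = (\<integral>w. f w \<partial>circle_measure)"
  using integral_distr[of "\<lambda>w. u * w" circle_measure borel f] distr_circle_measure_rotate[OF assms(1)]
  by simp

lemma integral_circle_square:
  fixes f :: "complex \<Rightarrow> real"
  assumes [measurable]: "f \<in> borel_measurable borel"
  shows "(\<integral>w. f (w\<^sup>2) \<partial>circle_measure) = (\<integral>w. f w \<partial>circle_measure)"
  using integral_distr[of "\<lambda>w. w\<^sup>2" circle_measure borel f] distr_circle_measure_square
  by simp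

text \<open>Since \<open>(1 + u w) (1 - u w) = 1 - u\<^sup>2 w\<^sup>2\<close>, the invariance of the measure under \<open>w \<mapsto> - w\<close> and
  \<open>w \<mapsto> w\<^sup>2\<close> doubles the mean of the logarithm.\<close>

lemma integral_ln_circle_double:
  assumes int: "\<And>v. cmod v = cmod u \<Longrightarrow> integrable circle_measure (\<lambda>w. ln (cmod (1 + v * w)))"
  shows "2 * (\<integral>w. ln (cmod (1 + u * w)) \<partial>circle_measure) =
    (\<integral>w. ln (cmod (1 + (- u\<^sup>2) * w)) \<partial>circle_measure)"
proof (cases "u = 0")
  case False
  have "2 * (\<integral>w. ln (cmod (1 + u * w)) \<partial>circle_measure) =
      (\<integral>w. ln (cmod (1 + u * w)) \<partial>circle_measure) + (\<integral>w. ln (cmod (1 + u * (- 1 * w))) \<partial>circle_measure)"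
    by (subst integral_circle_rotate[of "- 1" "\<lambda>w. ln (cmod (1 + u * w))"]) auto
  also have "\<dots> = (\<integral>w. ln (cmod (1 + u * w)) + ln (cmod (1 + (- u) * w)) \<partial>circle_measure)"
    using int[of u] int[of "- u"] by (subst Bochner_Integration.integral_add) auto
  also have "\<dots> = (\<integral>w. ln (cmod (1 + (- u\<^sup>2) * w\<^sup>2)) \<partial>circle_measure)"
  proof (rule integral_cong_AE)
    show "AE w in circle_measure. ln (cmod (1 + u * w)) + ln (cmod (1 + (- u) * w)) =
        ln (cmod (1 + (- u\<^sup>2) * w\<^sup>2))"
      using AE_circle_measure_neq[of "- 1 / u"] AE_circle_measure_neq[of "1 / u"]
    proof eventually_elim
      case (elim w)
      have "1 + u * w \<noteq> 0" "1 + (- u) * w \<noteq> 0"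
        using one_plus_mult_neq_0[of u w] one_plus_mult_neq_0[of "- u" w] elim False by auto
      moreover have "1 + (- u\<^sup>2) * w\<^sup>2 = (1 + u * w) * (1 + (- u) * w)"
        by (simp add: algebra_simps power2_eq_square)
      ultimately show ?case by (simp add: norm_mult ln_mult)
    qed
  qed measurable
  also have "\<dots> = (\<integral>w. ln (cmod (1 + (- u\<^sup>2) * w)) \<partial>circle_measure)"
    by (rule integral_circle_square) measurable
  finally show ?thesis .
qed simp

text \<open>The doubling formula sends \<open>u\<close> to \<open>- u\<^sup>2\<close>, which stays
  in the disc of radius |u|. On that disc the mean is bounded, so after k doublings 2^k |J u| is
  still below the same bound; hence J u = 0.\<close>

lemma integral_ln_circle_less:
  assumes "cmod u < 1"
  shows "(\<integral>w. ln (cmod (1 + u * w)) \<partial>circle_measure) = 0"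
proof -
  define J where "J = (\<lambda>u. \<integral>w. ln (cmod (1 + u * w)) \<partial>circle_measure)"
  have bound: "\<bar>J v\<bar> \<le> - ln (1 - cmod u)" if "cmod v \<le> cmod u" for v
  proof -
    have v: "cmod v < 1" using that assms by simp
    have "\<bar>J v\<bar> \<le> (\<integral>w. \<bar>ln (cmod (1 + v * w))\<bar> \<partial>circle_measure)"
      unfolding J_def by (rule integral_abs_bound)
    also have "\<dots> \<le> (\<integral>w. - ln (1 - cmod v) \<partial>circle_measure)"
    proof (rule integral_mono_AE)
      show "AE w in circle_measure. \<bar>ln (cmod (1 + v * w))\<bar> \<le> - ln (1 - cmod v)"
        using AE_circle_measure_norm by eventually_elim (rule circle_ln_bound[OF v])
    qed (use integrable_ln_circle_less[OF v] in auto)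
    also have "\<dots> = - ln (1 - cmod v)" by (simp add: circle.prob_space[simplified])
    also have "\<dots> \<le> - ln (1 - cmod u)" using that assms by simp
    finally show ?thesis .
  qed
  have double: "2 * J v = J (- v\<^sup>2)" if "cmod v < 1" for v
    unfolding J_def
    by (rule integral_ln_circle_double) (use that integrable_ln_circle_less in auto)
  have "2 ^ k * \<bar>J v\<bar> \<le> - ln (1 - cmod u)" if "cmod v \<le> cmod u" for v k
    using that
  proof (induction k arbitrary: v)
    case 0
    thus ?case using bound by simp
  next
    case (Suc k)
    have "cmod (- v\<^sup>2) = (cmod v)\<^sup>2"
      by (simp add: norm_power)
    also have "\<dots> \<le> cmod v"
      using Suc.prems assms by (simp add: power2_eq_square mult_left_le)
    finally have "cmod (- v\<^sup>2) \<le> cmod v" .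
    hence "2 ^ k * \<bar>J (- v\<^sup>2)\<bar> \<le> - ln (1 - cmod u)"
      using Suc by (meson order.trans)
    moreover have "\<bar>J (- v\<^sup>2)\<bar> = 2 * \<bar>J v\<bar>"
      using double[of v] Suc.prems assms by simp
    ultimately show ?case by simp
  qed
  hence le: "2 ^ k * \<bar>J u\<bar> \<le> - ln (1 - cmod u)" for k by simp
  have "J u = 0"
  proof (rule ccontr)
    assume "J u \<noteq> 0"
    obtain k where "- ln (1 - cmod u) / \<bar>J u\<bar> < 2 ^ k"
      using real_arch_pow[of 2] by auto
    thus False using le[of k] \<open>J u \<noteq> 0\<close> by (simp add: field_simps)
  qed
  thus ?thesis by (simp add: J_def)
qed

text \<open>The logarithm now has a singularity on the circle. Radii \<open>r k\<close> tending to 1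
  approximate it from inside, where the mean is known to be 0. Subtracting from \<open>ln 2\<close>
  makes the integrands nonnegative almost everywhere, since the moduli are at most 2, and Fatou's
  lemma bounds the limit by \<open>ln 2\<close>.\<close>

lemma integrable_ln_circle_eq:
  assumes "cmod u = 1"
  shows "integrable circle_measure (\<lambda>w. ln (cmod (1 + u * w)))"
proof -
  have u: "u \<noteq> 0" using assms by auto
  define r where "r = (\<lambda>k. 1 + - inverse (real (Suc k)))"
  have r: "0 \<le> r k" "r k < 1" for k by (auto simp: r_def field_simps)
  have r_lim: "r \<longlonglongrightarrow> 1"
    unfolding r_def by (rule LIMSEQ_inverse_real_of_nat_add_minus)
  have cr: "cmod (of_real (r k) * u) < 1" for k
    using r[of k] assms by (simp add: norm_mult)
  define f where "f = (\<lambda>k w. ln 2 - ln (cmod (1 + (of_real (r k) * u) * w)))"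
  define g where "g = (\<lambda>w. ln 2 - ln (cmod (1 + u * w)))"
  have g_nonneg: "AE w in circle_measure. 0 \<le> g w"
    using AE_circle_measure_norm AE_circle_measure_neq[of "- 1 / u"]
  proof eventually_elim
    case (elim w)
    have "1 + u * w \<noteq> 0" using elim assms by (intro one_plus_mult_neq_0) auto
    moreover have "cmod (1 + u * w) \<le> 2"
      using norm_triangle_ineq[of 1 "u * w"] elim assms by (simp add: norm_mult)
    ultimately show ?case by (simp add: g_def)
  qed
  have "(\<integral>\<^sup>+w. ennreal (g w) \<partial>circle_measure) = (\<integral>\<^sup>+w. liminf (\<lambda>k. ennreal (f k w)) \<partial>circle_measure)"
  proof (rule nn_integral_cong_AE)
    show "AE w in circle_measure. ennreal (g w) = liminf (\<lambda>k. ennreal (f k w))"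
      using AE_circle_measure_neq[of "- 1 / u"]
    proof eventually_elim
      case (elim w)
      have nz: "1 + of_real 1 * u * w \<noteq> 0"
        using one_plus_mult_neq_0[of u w] elim u by simp
      have "(\<lambda>k. f k w) \<longlonglongrightarrow> ln 2 - ln (cmod (1 + of_real 1 * u * w))"
        unfolding f_def using nz by (intro tendsto_intros r_lim) auto
      hence "(\<lambda>k. ennreal (f k w)) \<longlonglongrightarrow> ennreal (g w)"
        by (intro tendsto_ennrealI) (simp add: g_def)
      thus ?case by (intro lim_imp_Liminf[symmetric]) auto
    qed
  qed
  also have "\<dots> \<le> liminf (\<lambda>k. \<integral>\<^sup>+w. ennreal (f k w) \<partial>circle_measure)"
    unfolding f_def by (rule nn_integral_liminf) measurable
  also have "(\<lambda>k. \<integral>\<^sup>+w. ennreal (f k w) \<partial>circle_measure) = (\<lambda>k. ennreal (ln 2))"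
  proof
    fix k
    have int: "integrable circle_measure (f k)"
      unfolding f_def using integrable_ln_circle_less[OF cr] by auto
    have "AE w in circle_measure. 0 \<le> f k w"
      using AE_circle_measure_norm
    proof eventually_elim
      case (elim w)
      have "cmod (1 + (of_real (r k) * u) * w) \<le> 2"
        using norm_triangle_ineq[of 1 "of_real (r k) * u * w"] elim assms r[of k] by (simp add: norm_mult)
      moreover have "cmod (1 + (of_real (r k) * u) * w) \<ge> 1 - r k"
        using norm_diff_ineq[of 1 "of_real (r k) * u * w"] elim assms r[of k] by (simp add: norm_mult)
      ultimately show ?case unfolding f_def using r[of k]
        by (subst diff_ge_0_iff_ge, subst ln_le_cancel_iff) auto
    qed
    hence "(\<integral>\<^sup>+w. ennreal (f k w) \<partial>circle_measure) = ennreal (\<integral>w. f k w \<partial>circle_measure)"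
      using int by (intro nn_integral_eq_integral)
    also have "(\<integral>w. f k w \<partial>circle_measure) = ln 2"
      unfolding f_def using integrable_ln_circle_less[OF cr] integral_ln_circle_less[OF cr]
      by (simp add: circle.prob_space[simplified])
    finally show "(\<integral>\<^sup>+w. ennreal (f k w) \<partial>circle_measure) = ennreal (ln 2)" .
  qed
  finally have "(\<integral>\<^sup>+w. ennreal (g w) \<partial>circle_measure) \<le> ennreal (ln 2)"
    by (simp add: Liminf_const)
  hence "(\<integral>\<^sup>+w. ennreal (g w) \<partial>circle_measure) < \<infinity>"
    using order.strict_trans1 by fastforce
  hence "integrable circle_measure g"
    by (intro integrableI_nonneg g_nonneg) (auto simp: g_def)
  hence "integrable circle_measure (\<lambda>w. ln 2 - g w)" by auto
  thus ?thesis by (simp add: g_def)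
qed

text \<open>Doubling leads to \<open>- u\<^sup>2\<close>, again of modulus 1, and a rotation of
  \<open>w\<close> by \<open>- u\<close> turns it back into \<open>u\<close>. Thus the mean equals
  twice itself; integrability makes this conclusive.\<close>

lemma integral_ln_circle_eq:
  assumes "cmod u = 1"
  shows "(\<integral>w. ln (cmod (1 + u * w)) \<partial>circle_measure) = 0"
proof -
  let ?J = "\<lambda>u. \<integral>w. ln (cmod (1 + u * w)) \<partial>circle_measure"
  have "2 * ?J u = ?J (- u\<^sup>2)"
    by (rule integral_ln_circle_double) (use assms integrable_ln_circle_eq in auto)
  also have "\<dots> = (\<integral>w. ln (cmod (1 + u * (- u * w))) \<partial>circle_measure)"
    by (simp add: power2_eq_square mult.assoc)
  also have "\<dots> = ?J u"
    using assms by (intro integral_circle_rotate) auto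
  finally show ?thesis by simp
qed

text \<open>If |b| > |a|, the zero of a + w b lies inside the disc and is reflected: on the circle w
  cnj w = 1, so a + w b = w b cnj (1 + cnj (a/b) w). The constant \<open>c\<close> is the larger of
  |a| and |b|.\<close>

lemma cmod_affine_circle:
  fixes a b :: complex
  assumes "a \<noteq> 0"
  obtains u c where "cmod u \<le> 1" "cmod a \<le> c" "cmod a = cmod b \<longrightarrow> c = cmod a"
    "\<And>w. cmod w = 1 \<Longrightarrow> cmod (a + w * b) = c * cmod (1 + u * w)"
proof (cases "cmod b \<le> cmod a")
  case True
  have "a + w * b = a * (1 + (b / a) * w)" for w
    using assms by (simp add: field_simps)
  hence "cmod (a + w * b) = cmod a * cmod (1 + (b / a) * w)" for w
    by (metis norm_mult)
  moreover have "cmod (b / a) \<le> 1"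
    using True assms by (simp add: norm_divide)
  ultimately show ?thesis using that by blast
next
  case False
  hence b: "b \<noteq> 0" by auto
  have "cmod (a + w * b) = cmod b * cmod (1 + cnj (a / b) * w)" if "cmod w = 1" for w
  proof -
    have "w * cnj w = 1" using that complex_norm_square[of w] by simp
    hence "a + w * b = b * (w * cnj (1 + cnj (a / b) * w))"
      using b by (simp add: field_simps)
    hence "cmod (a + w * b) = cmod b * (cmod w * cmod (1 + cnj (a / b) * w))"
      by (simp only: norm_mult complex_mod_cnj)
    thus ?thesis using that by simp
  qed
  moreover have "cmod (cnj (a / b)) \<le> 1"
    using False b by (simp add: norm_divide divide_le_eq_1)
  ultimately show ?thesis using that[of "cnj (a / b)" "cmod b"] False by simp
qed

text \<open>Jensen's formula for an affine function: the mean is ln (max |a| |b|). The case |a| =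
  |b|, where nothing is lost, is what permits a factor with a negative exponent.\<close>

lemma ln_affine_circle:
  fixes a b :: complex
  assumes "a \<noteq> 0"
  shows "integrable circle_measure (\<lambda>w. ln (cmod (a + w * b)))" (is ?int)
    and "ln (cmod a) \<le> (\<integral>w. ln (cmod (a + w * b)) \<partial>circle_measure)" (is ?le)
    and "cmod a = cmod b \<Longrightarrow> (\<integral>w. ln (cmod (a + w * b)) \<partial>circle_measure) = ln (cmod a)"
proof -
  obtain u c where u: "cmod u \<le> 1" and c: "cmod a \<le> c" "cmod a = cmod b \<longrightarrow> c = cmod a"
    and uc: "\<And>w. cmod w = 1 \<Longrightarrow> cmod (a + w * b) = c * cmod (1 + u * w)"
    using cmod_affine_circle[OF assms, of b] by blast
  have c_pos: "c > 0" using assms c(1) by (metis order.strict_trans1 not_le norm_le_zero_iff)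
  have eq: "AE w in circle_measure. ln c + ln (cmod (1 + u * w)) = ln (cmod (a + w * b))"
    using AE_circle_measure_norm AE_circle_measure_neq[of "- 1 / u"]
  proof eventually_elim
    case (elim w)
    have "1 + u * w \<noteq> 0" using elim one_plus_mult_neq_0[of u w] by (cases "u = 0") auto
    thus ?case using c_pos elim by (simp add: uc ln_mult)
  qed
  have J: "integrable circle_measure (\<lambda>w. ln (cmod (1 + u * w)))"
    "(\<integral>w. ln (cmod (1 + u * w)) \<partial>circle_measure) = 0"
    using u integrable_ln_circle_less integrable_ln_circle_eq integral_ln_circle_less
      integral_ln_circle_eq by (cases "cmod u = 1"; simp)+
  have int: "integrable circle_measure (\<lambda>w. ln c + ln (cmod (1 + u * w)))"
    using J by auto
  show ?int
    using int by (rule integrable_cong_AE_imp) (use eq in auto)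
  have "(\<integral>w. ln (cmod (a + w * b)) \<partial>circle_measure) =
      (\<integral>w. ln c + ln (cmod (1 + u * w)) \<partial>circle_measure)"
    by (rule integral_cong_AE) (use eq in \<open>auto elim: eventually_mono\<close>)
  also have "\<dots> = ln c"
    using J by (simp add: circle.prob_space[simplified])
  finally have int_eq: "(\<integral>w. ln (cmod (a + w * b)) \<partial>circle_measure) = ln c" .
  show ?le using int_eq c assms c_pos by simp
  show "(\<integral>w. ln (cmod (a + w * b)) \<partial>circle_measure) = ln (cmod a)" if "cmod a = cmod b"
    using int_eq c that by simp
qed

text \<open>This turns an identity valid almost everywhere on the circle into one at a single
  prescribed point, needed where the exceptional null set contains exactly the point of
  interest.\<close>

lemma continuous_eq_AE_circle:
  fixes f g :: "complex \<Rightarrow> real"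
  assumes "continuous_on UNIV f" "continuous_on UNIV g"
    and AE: "AE w in circle_measure. f w = g w" and "cmod u = 1"
  shows "f u = g u"
proof -
  have [measurable]: "f \<in> borel_measurable borel" "g \<in> borel_measurable borel"
    using assms by (auto intro: borel_measurable_continuous_onI)
  define C where "C = {x. f (cis x) = g (cis x)}"
  have "closed C"
    unfolding C_def
    by (intro closed_Collect_eq continuous_on_compose2[OF assms(1)] continuous_on_compose2[OF assms(2)]
        continuous_intros) auto
  have "AE x in lborel. x \<in> {0..<2 * pi} \<longrightarrow> f (cis x) = g (cis x)"
    using AE by (subst (asm) AE_circle_measure_iff) auto
  hence "AE x\<in>{0<..<2 * pi} in lebesgue. x \<in> C"
    by (intro AE_completion) (auto simp: C_def elim: eventually_mono)
  hence C: "x \<in> C" if "x \<in> {0<..<2 * pi}" for x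
    using \<open>closed C\<close> that mem_closed_if_AE_lebesgue_open[of "{0<..<2 * pi}" C x] by auto
  \<comment> \<open>The open interval gives density of \<open>C\<close>; closedness adds the end
    points and with them the angle 0.\<close>
  have "{0..2 * pi} \<subseteq> C"
    using closure_minimal[of "{0<..<2 * pi}" C] C \<open>closed C\<close>
    by (simp add: closure_greaterThanLessThan subset_iff)
  moreover have "u = cis (Arg2pi u)" "Arg2pi u \<in> {0..2 * pi}"
    using Arg2pi[of u] Arg2pi_eq[of u] assms(4)
    by (metis cis_conv_exp mult_1 of_real_1, auto)
  ultimately have "f (cis (Arg2pi u)) = g (cis (Arg2pi u))"
    unfolding C_def by blast
  thus ?thesis using \<open>u = cis (Arg2pi u)\<close> by simp
qed

text \<open>The mean of ln h is at least ln (h 0): the factors with exponent \<open>p\<close> can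
  only gain, and the factor with exponent \<open>- q\<close> is exact because |l| = |cnj l|.
  Jensen's inequality for \<open>exp\<close> then gives the claim, with equality only if h is almost
  everywhere constant on the circle.\<close>

lemma circle_product_mean:
  fixes a b :: "'j \<Rightarrow> complex" and l :: complex and p q :: real
  assumes "finite J" "\<And>j. j \<in> J \<Longrightarrow> a j \<noteq> 0" "l \<noteq> 0" "p > 0" "q > 0"
  defines "h \<equiv> \<lambda>w. (\<Prod>j\<in>J. cmod (a j + w * b j)) powr p * cmod (l + w * cnj l) powr (- q)"
  shows "ennreal (h 0) \<le> (\<integral>\<^sup>+w. ennreal (h w) \<partial>circle_measure)"
    and "(\<And>j. j \<in> J \<Longrightarrow> a j * cnj l \<noteq> l * b j) \<Longrightarrow>
      ennreal (h 0) < (\<integral>\<^sup>+w. ennreal (h w) \<partial>circle_measure)"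
proof -
  define g where "g = (\<lambda>w. p * (\<Sum>j\<in>J. ln (cmod (a j + w * b j))) - q * ln (cmod (l + w * cnj l)))"
  have h_g: "h w = exp (g w)" if "\<And>j. j \<in> J \<Longrightarrow> a j + w * b j \<noteq> 0" "l + w * cnj l \<noteq> 0" for w
  proof -
    have "ln (\<Prod>j\<in>J. cmod (a j + w * b j)) = (\<Sum>j\<in>J. ln (cmod (a j + w * b j)))"
      using assms(1) that by (intro ln_prod) auto
    moreover have "(\<Prod>j\<in>J. cmod (a j + w * b j)) \<noteq> 0"
      using assms(1) that by auto
    ultimately show ?thesis
      using that(2) by (simp add: h_def g_def powr_def exp_diff exp_minus divide_inverse)
  qed
  have nz: "AE w in circle_measure. (\<forall>j\<in>J. a j + w * b j \<noteq> 0) \<and> l + w * cnj l \<noteq> 0"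
  proof -
    have *: "AE w in circle_measure. x + w * y \<noteq> 0" if "x \<noteq> 0" for x y
      using AE_circle_measure_neq[of "- x / y"]
      by eventually_elim (cases "y = 0"; use that in \<open>auto simp: field_simps add_eq_0_iff\<close>)
    show ?thesis
      using assms * by (intro AE_conjI AE_finite_allI) auto
  qed
  have h_g_AE: "AE w in circle_measure. h w = exp (g w)"
    using nz by eventually_elim (auto intro: h_g)
  have h0: "h 0 = exp (g 0)" using assms by (intro h_g) auto
  have int: "integrable circle_measure g"
    unfolding g_def using assms
    by (intro Bochner_Integration.integrable_diff integrable_mult_right Bochner_Integration.integrable_sum
        ln_affine_circle) auto
  have le: "g 0 \<le> (\<integral>w. g w \<partial>circle_measure)"
  proof -
    have "(\<integral>w. g w \<partial>circle_measure) =
        p * (\<Sum>j\<in>J. \<integral>w. ln (cmod (a j + w * b j)) \<partial>circle_measure) - q * ln (cmod l)"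
      unfolding g_def using assms ln_affine_circle
      by (subst Bochner_Integration.integral_diff)
         (auto simp: Bochner_Integration.integral_sum ln_affine_circle)
    moreover have "(\<Sum>j\<in>J. ln (cmod (a j))) \<le> (\<Sum>j\<in>J. \<integral>w. ln (cmod (a j + w * b j)) \<partial>circle_measure)"
      using assms by (intro sum_mono ln_affine_circle) auto
    ultimately show ?thesis using assms by (simp add: g_def)
  qed
  have nn: "(\<integral>\<^sup>+w. ennreal (h w) \<partial>circle_measure) = (\<integral>\<^sup>+w. ennreal (exp (g w)) \<partial>circle_measure)"
    using h_g_AE by (intro nn_integral_cong_AE) (auto elim: eventually_mono)
  show "ennreal (h 0) \<le> (\<integral>\<^sup>+w. ennreal (h w) \<partial>circle_measure)"
    unfolding nn h0 by (rule circle.nn_integral_exp_ge(1)[OF int le])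
  assume neq: "\<And>j. j \<in> J \<Longrightarrow> a j * cnj l \<noteq> l * b j"
  show "ennreal (h 0) < (\<integral>\<^sup>+w. ennreal (h w) \<partial>circle_measure)"
    unfolding nn h0
  proof (rule circle.nn_integral_exp_ge(2)[OF int le], rule notI)
    assume "AE w in circle_measure. g w = g 0"
    \<comment> \<open>Multiplying by the denominator makes both sides continuous, also at the zero
      of \<open>l + w * cnj l\<close>.\<close>
    with h_g_AE nz have AE: "AE w in circle_measure.
        (\<Prod>j\<in>J. cmod (a j + w * b j)) powr p = h 0 * cmod (l + w * cnj l) powr q"
    proof eventually_elim
      case (elim w)
      hence "(\<Prod>j\<in>J. cmod (a j + w * b j)) powr p * cmod (l + w * cnj l) powr (- q) = h 0"
        by (simp add: h0) (simp add: h_def)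
      thus ?case using elim by (auto simp: powr_minus field_simps)
    qed
    \<comment> \<open>The zero of \<open>l + w * cnj l\<close>; it lies on the circle, and some
      numerator factor must vanish there as well.\<close>
    define u where "u = - l / cnj l"
    have "cmod u = 1" using assms by (simp add: u_def norm_divide)
    have "(\<Prod>j\<in>J. cmod (a j + u * b j)) powr p = h 0 * cmod (l + u * cnj l) powr q"
    proof (rule continuous_eq_AE_circle[OF _ _ AE \<open>cmod u = 1\<close>])
      have cont: "continuous_on UNIV (\<lambda>w. f w powr r)"
        if "continuous_on UNIV f" "\<And>w. f w \<ge> 0" "r > 0" for f :: "complex \<Rightarrow> real" and r
        using that by (intro continuous_on_powr') auto
      show "continuous_on UNIV (\<lambda>w. (\<Prod>j\<in>J. cmod (a j + w * b j)) powr p)"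
        using assms by (intro cont continuous_intros prod_nonneg) auto
      show "continuous_on UNIV (\<lambda>w. h 0 * cmod (l + w * cnj l) powr q)"
        using assms by (intro continuous_on_mult continuous_on_const cont) (auto intro!: continuous_intros)
    qed
    also have "l + u * cnj l = 0" using assms by (simp add: u_def)
    finally have "(\<Prod>j\<in>J. cmod (a j + u * b j)) = 0" using assms by simp
    then obtain j where "j \<in> J" "a j + u * b j = 0" using assms(1) by auto
    hence "a j * cnj l = l * b j" using assms by (simp add: u_def field_simps)
    thus False using neq \<open>j \<in> J\<close> by blast
  qed
qed

section \<open>Areas of homogeneous regions\<close>

lemma measurable_fst_snd_plane [measurable]:
  "(fst :: real \<times> real \<Rightarrow> real) \<in> borel_measurable borel"
  "(snd :: real \<times> real \<Rightarrow> real) \<in> borel_measurable borel"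
  by (intro borel_measurable_continuous_onI continuous_intros)+

lemma nn_integral_abs_interval:
  assumes "R \<ge> 0"
  shows "(\<integral>\<^sup>+y. ennreal \<bar>y\<bar> * indicator {- R..R} y \<partial>lborel) = ennreal (R\<^sup>2)"
proof -
  have "(\<integral>\<^sup>+y. ennreal \<bar>y\<bar> * indicator {- R..R} y \<partial>lborel) =
      (\<integral>\<^sup>+y. ennreal y * indicator {0..R} y + ennreal (- y) * indicator {- R..0} y \<partial>lborel)"
    by (intro nn_integral_cong) (auto split: split_indicator simp: abs_if)
  also have "\<dots> = (\<integral>\<^sup>+y. ennreal y * indicator {0..R} y \<partial>lborel) +
      (\<integral>\<^sup>+y. ennreal (- y) * indicator {- R..0} y \<partial>lborel)"
    by (rule nn_integral_add) auto
  also have "(\<integral>\<^sup>+y. ennreal y * indicator {0..R} y \<partial>lborel) = ennreal (R\<^sup>2 / 2 - 0\<^sup>2 / 2)"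
    by (rule nn_integral_FTC_Icc[where F = "\<lambda>y. y\<^sup>2 / 2"])
       (use assms in \<open>auto intro!: derivative_eq_intros simp: has_real_derivative_iff_has_vector_derivative[symmetric]\<close>)
  also have "(\<integral>\<^sup>+y. ennreal (- y) * indicator {- R..0} y \<partial>lborel) =
      ennreal (- (0\<^sup>2) / 2 - (- ((- R)\<^sup>2) / 2))"
    by (rule nn_integral_FTC_Icc[where F = "\<lambda>y. - (y\<^sup>2) / 2"])
       (use assms in \<open>auto intro!: derivative_eq_intros simp: has_real_derivative_iff_has_vector_derivative[symmetric]\<close>)
  finally show ?thesis by (simp flip: ennreal_plus)
qed

text \<open>Tonelli in the coordinates \<open>x = t y\<close>. The points with \<open>y = 0\<close>, where \<open>x / y = 0\<close>, form a null set.\<close>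

lemma homogeneous_sector_area:
  fixes N :: "real \<Rightarrow> real \<Rightarrow> real" and n :: nat
  assumes N [measurable]: "(\<lambda>z. N (fst z) (snd z)) \<in> borel_measurable borel"
    and "n > 0"
    and hom: "\<And>s x y. N (s * x) (s * y) = \<bar>s\<bar> ^ n * N x y"
    and nonneg: "\<And>x y. N x y \<ge> 0"
    and nz: "AE t in lborel. N t 1 \<noteq> 0"
    and E [measurable]: "E \<in> sets borel"
  shows "emeasure lborel {(x, y). N x y \<le> 1 \<and> x / y \<in> E} =
    (\<integral>\<^sup>+t. ennreal (N t 1 powr (- 2 / real n)) * indicator E t \<partial>lborel)"
proof -
  have N2 [measurable (raw)]: "(\<lambda>w. N (f w) (g w)) \<in> borel_measurable M"
    if "f \<in> borel_measurable M" "g \<in> borel_measurable M" for f g and M :: "'c measure"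
    using measurable_compose[OF borel_measurable_Pair[OF that] N] by simp
  define S where "S = {(x, y). N x y \<le> 1 \<and> x / y \<in> E}"
  have S: "S \<in> sets borel"
  proof -
    have "{z \<in> space borel. N (fst z) (snd z) \<le> 1 \<and> fst z / snd z \<in> E} \<in> sets borel"
      by measurable
    thus ?thesis by (simp add: S_def case_prod_beta)
  qed
  have S' [measurable]: "S \<in> sets (lborel \<Otimes>\<^sub>M lborel)"
    using S by (simp only: lborel_prod sets_lborel)
  have "emeasure lborel S = (\<integral>\<^sup>+z. indicator S z \<partial>(lborel \<Otimes>\<^sub>M lborel))"
    using S by (simp add: lborel_prod)
  also have "\<dots> = (\<integral>\<^sup>+y. \<integral>\<^sup>+x. indicator S (x, y) \<partial>lborel \<partial>lborel)"
    by (rule lborel_pair.nn_integral_snd[symmetric]) measurable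
  also have "\<dots> = (\<integral>\<^sup>+y. \<integral>\<^sup>+t. ennreal \<bar>y\<bar> * indicator {y. \<bar>y\<bar> ^ n * N t 1 \<le> 1} y * indicator E t \<partial>lborel \<partial>lborel)"
  proof (rule nn_integral_cong_AE)
    show "AE y in lborel. (\<integral>\<^sup>+x. indicator S (x, y) \<partial>lborel) =
        (\<integral>\<^sup>+t. ennreal \<bar>y\<bar> * indicator {y. \<bar>y\<bar> ^ n * N t 1 \<le> 1} y * indicator E t \<partial>lborel)"
      using AE_lborel_singleton[of 0]
    proof eventually_elim
      case (elim y)
      have "(\<integral>\<^sup>+x. indicator S (x, y) \<partial>lborel) = \<bar>y\<bar> * (\<integral>\<^sup>+t. indicator S (0 + y * t, y) \<partial>lborel)"
        using elim by (intro nn_integral_real_affine) measurable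
      also have "\<dots> = (\<integral>\<^sup>+t. ennreal \<bar>y\<bar> * indicator S (0 + y * t, y) \<partial>lborel)"
        by (rule nn_integral_cmult[symmetric]) measurable
      also have "\<dots> = (\<integral>\<^sup>+t. ennreal \<bar>y\<bar> * indicator {y. \<bar>y\<bar> ^ n * N t 1 \<le> 1} y * indicator E t \<partial>lborel)"
      proof (rule nn_integral_cong)
        fix t
        have "N (y * t) y = \<bar>y\<bar> ^ n * N t 1" using hom[of y t 1] by simp
        thus "ennreal \<bar>y\<bar> * indicator S (0 + y * t, y) =
            ennreal \<bar>y\<bar> * indicator {y. \<bar>y\<bar> ^ n * N t 1 \<le> 1} y * indicator E t"
          using elim by (auto simp: S_def split: split_indicator)
      qed
      finally show ?case .
    qed
  qed
  also have "\<dots> = (\<integral>\<^sup>+t. \<integral>\<^sup>+y. ennreal \<bar>y\<bar> * indicator {y. \<bar>y\<bar> ^ n * N t 1 \<le> 1} y * indicator E t \<partial>lborel \<partial>lborel)"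
    by (rule lborel_pair.Fubini') measurable
  also have "\<dots> = (\<integral>\<^sup>+t. ennreal (N t 1 powr (- 2 / real n)) * indicator E t \<partial>lborel)"
  proof (rule nn_integral_cong_AE)
    show "AE t in lborel. (\<integral>\<^sup>+y. ennreal \<bar>y\<bar> * indicator {y. \<bar>y\<bar> ^ n * N t 1 \<le> 1} y * indicator E t \<partial>lborel) =
        ennreal (N t 1 powr (- 2 / real n)) * indicator E t"
      using nz
    proof eventually_elim
      case (elim t)
      \<comment> \<open>For fixed t the admissible y form the interval [-R, R], over which |y|
        integrates to R^2; this is the origin of the exponent - 2 / n.\<close>
      define R where "R = N t 1 powr (- 1 / real n)"
      have pos: "N t 1 > 0" using elim nonneg[of t 1] by simp
      have "R > 0" using pos by (simp add: R_def)
      have Rn: "R ^ n = inverse (N t 1)"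
      proof -
        have "R ^ n = N t 1 powr (- 1)"
          unfolding R_def using pos \<open>n > 0\<close> by (subst powr_power) auto
        thus ?thesis using pos by (simp add: powr_minus)
      qed
      have "{y. \<bar>y\<bar> ^ n * N t 1 \<le> 1} = {- R..R}"
      proof -
        have le: "\<bar>y\<bar> ^ n * N t 1 \<le> 1 \<longleftrightarrow> \<bar>y\<bar> \<le> R" for y
        proof -
          have "\<bar>y\<bar> ^ n * N t 1 \<le> 1 \<longleftrightarrow> \<bar>y\<bar> ^ n \<le> R ^ n"
            using pos by (simp add: Rn field_simps)
          also have "\<dots> \<longleftrightarrow> \<bar>y\<bar> \<le> R"
            using \<open>R > 0\<close> \<open>n > 0\<close> by (intro power_mono_iff) auto
          finally show ?thesis .
        qed
        show ?thesis unfolding le by (auto simp: abs_le_iff)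
      qed
      moreover have "R\<^sup>2 = N t 1 powr (- 2 / real n)"
        unfolding R_def using pos by (subst powr_power) auto
      ultimately show ?case
        using nn_integral_abs_interval[of R] \<open>R > 0\<close> by (simp add: nn_integral_multc)
    qed
  qed
  finally show ?thesis unfolding S_def .
qed

lemma homogeneous_area:
  fixes N :: "real \<Rightarrow> real \<Rightarrow> real" and n :: nat
  assumes "(\<lambda>z. N (fst z) (snd z)) \<in> borel_measurable borel" "n > 0"
    "\<And>s x y. N (s * x) (s * y) = \<bar>s\<bar> ^ n * N x y" "\<And>x y. N x y \<ge> 0" "AE t in lborel. N t 1 \<noteq> 0"
  shows "emeasure lborel {(x, y). N x y \<le> 1} = (\<integral>\<^sup>+t. ennreal (N t 1 powr (- 2 / real n)) \<partial>lborel)"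
  using homogeneous_sector_area[OF assms, of UNIV] by simp

section \<open>Linear changes of variables and the area of the split cubic\<close>

lemma nn_integral_linear_plane:
  fixes f :: "real \<times> real \<Rightarrow> ennreal" and a b c d :: real
  assumes f [measurable]: "f \<in> borel_measurable borel" and det: "a * d - b * c \<noteq> 0"
  shows "(\<integral>\<^sup>+z. f z \<partial>lborel) =
    \<bar>a * d - b * c\<bar> * (\<integral>\<^sup>+z. f (a * fst z + b * snd z, c * fst z + d * snd z) \<partial>lborel)"
proof -
  have f2 [measurable (raw)]: "(\<lambda>w. f (g w, h w)) \<in> borel_measurable M"
    if "g \<in> borel_measurable M" "h \<in> borel_measurable M" for g h and M :: "'c measure"
    using measurable_compose[OF borel_measurable_Pair[OF that] f] by simp
  have prod: "(\<integral>\<^sup>+z. g z \<partial>lborel) = (\<integral>\<^sup>+y. \<integral>\<^sup>+x. g (x, y) \<partial>lborel \<partial>lborel)"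
    if "g \<in> borel_measurable borel" for g :: "real \<times> real \<Rightarrow> ennreal"
    using that by (subst lborel_pair.nn_integral_snd) (simp_all add: lborel_prod)
  have fub: "(\<integral>\<^sup>+z. f z \<partial>lborel) = (\<integral>\<^sup>+x. \<integral>\<^sup>+y. f (x, y) \<partial>lborel \<partial>lborel)"
    by (subst prod[OF f], rule lborel_pair.Fubini') measurable
  have lhs: "(\<integral>\<^sup>+z. f (a * fst z + b * snd z, c * fst z + d * snd z) \<partial>lborel) =
      (\<integral>\<^sup>+y. \<integral>\<^sup>+x. f (a * x + b * y, c * x + d * y) \<partial>lborel \<partial>lborel)"
  proof -
    have "(\<lambda>z. f (a * fst z + b * snd z, c * fst z + d * snd z)) \<in> borel_measurable borel"
      by (rule f2) measurable
    from prod[OF this] show ?thesis by simp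
  qed
  show ?thesis
  proof (cases "a = 0")
    case True
    hence bc: "b \<noteq> 0" "c \<noteq> 0" using det by auto
    have "(\<integral>\<^sup>+z. f z \<partial>lborel) = \<bar>b\<bar> * (\<integral>\<^sup>+y. \<integral>\<^sup>+v. f (0 + b * y, v) \<partial>lborel \<partial>lborel)"
      unfolding fub using bc by (intro nn_integral_real_affine) measurable
    also have "(\<integral>\<^sup>+y. \<integral>\<^sup>+v. f (0 + b * y, v) \<partial>lborel \<partial>lborel) =
        (\<integral>\<^sup>+y. \<bar>c\<bar> * (\<integral>\<^sup>+x. f (0 + b * y, d * y + c * x) \<partial>lborel) \<partial>lborel)"
      using bc by (intro nn_integral_cong nn_integral_real_affine) measurable
    also have "\<dots> = \<bar>c\<bar> * (\<integral>\<^sup>+y. \<integral>\<^sup>+x. f (0 + b * y, d * y + c * x) \<partial>lborel \<partial>lborel)"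
      by (rule nn_integral_cmult) measurable
    finally show ?thesis
      unfolding lhs using True by (simp add: mult.assoc[symmetric] ennreal_mult'[symmetric] abs_mult add.commute)
  next
    case False
    \<comment> \<open>The determinant divided by \<open>a\<close>: after substituting u = a x + b y
      for fixed y, the second coordinate is c / a * u + e * y, so the remaining substitution in y
      has factor |e|.\<close>
    define e where "e = d - b * c / a"
    have e: "a * e = a * d - b * c" using False by (simp add: e_def field_simps)
    hence "e \<noteq> 0" using det by auto
    have "\<bar>e\<bar> * (\<integral>\<^sup>+y. \<bar>a\<bar> * (\<integral>\<^sup>+x. f (a * x + b * y, c * x + d * y) \<partial>lborel) \<partial>lborel) =
       \<bar>e\<bar> * (\<integral>\<^sup>+y. \<integral>\<^sup>+u. f (u, c / a * u + e * y) \<partial>lborel \<partial>lborel)"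
    proof (intro arg_cong2[where f = "(*)"] nn_integral_cong refl)
      fix y
      have "(\<integral>\<^sup>+u. f (u, c / a * u + e * y) \<partial>lborel) =
          \<bar>a\<bar> * (\<integral>\<^sup>+x. f (b * y + a * x, c / a * (b * y + a * x) + e * y) \<partial>lborel)"
        using False by (intro nn_integral_real_affine) measurable
      also have "(\<lambda>x. f (b * y + a * x, c / a * (b * y + a * x) + e * y)) = (\<lambda>x. f (a * x + b * y, c * x + d * y))"
      proof
        fix x
        have "c / a * (b * y + a * x) + e * y = c * x + d * y"
          using False by (simp add: e_def field_simps)
        thus "f (b * y + a * x, c / a * (b * y + a * x) + e * y) = f (a * x + b * y, c * x + d * y)"
          by (simp only: add.commute)
      qed
      finally show "\<bar>a\<bar> * (\<integral>\<^sup>+x. f (a * x + b * y, c * x + d * y) \<partial>lborel) =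
          (\<integral>\<^sup>+u. f (u, c / a * u + e * y) \<partial>lborel)" ..
    qed
    also have "(\<integral>\<^sup>+y. \<integral>\<^sup>+u. f (u, c / a * u + e * y) \<partial>lborel \<partial>lborel) =
        (\<integral>\<^sup>+u. \<integral>\<^sup>+y. f (u, c / a * u + e * y) \<partial>lborel \<partial>lborel)"
      by (rule lborel_pair.Fubini') measurable
    also have "\<bar>e\<bar> * \<dots> = (\<integral>\<^sup>+u. \<bar>e\<bar> * (\<integral>\<^sup>+y. f (u, c / a * u + e * y) \<partial>lborel) \<partial>lborel)"
      by (rule nn_integral_cmult[symmetric]) measurable
    also have "\<dots> = (\<integral>\<^sup>+u. \<integral>\<^sup>+v. f (u, v) \<partial>lborel \<partial>lborel)"
      using \<open>e \<noteq> 0\<close> by (intro nn_integral_cong nn_integral_real_affine[symmetric]) measurable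
    also have "\<dots> = (\<integral>\<^sup>+z. f z \<partial>lborel)" by (rule fub[symmetric])
    also have "(\<integral>\<^sup>+y. \<bar>a\<bar> * (\<integral>\<^sup>+x. f (a * x + b * y, c * x + d * y) \<partial>lborel) \<partial>lborel) =
        \<bar>a\<bar> * (\<integral>\<^sup>+y. \<integral>\<^sup>+x. f (a * x + b * y, c * x + d * y) \<partial>lborel \<partial>lborel)"
      by (rule nn_integral_cmult) measurable
    finally show ?thesis
      unfolding lhs e[symmetric] by (simp add: mult.assoc[symmetric] ennreal_mult'[symmetric] abs_mult mult.commute)
  qed
qed

lemma emeasure_linear_plane:
  fixes S :: "(real \<times> real) set" and a b c d :: real
  assumes [measurable]: "S \<in> sets borel" and det: "a * d - b * c \<noteq> 0"
  shows "emeasure lborel S =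
    \<bar>a * d - b * c\<bar> * emeasure lborel {(x, y). (a * x + b * y, c * x + d * y) \<in> S}"
proof -
  let ?T = "\<lambda>z. (a * fst z + b * snd z, c * fst z + d * snd z)"
  have "?T \<in> borel_measurable borel" by measurable
  hence "?T -` S \<in> sets borel" using measurable_sets[of ?T borel borel S] by simp
  moreover have "?T -` S = {(x, y). (a * x + b * y, c * x + d * y) \<in> S}" by auto
  moreover have "indicator S (?T z) = (indicator (?T -` S) z :: ennreal)" for z
    by (simp split: split_indicator)
  ultimately show ?thesis
    using nn_integral_linear_plane[OF _ det, of "indicator S"] by simp
qed

text \<open>The map (x, y) to (y, y - x) has determinant 1, preserves |x y (x - y)| and permutes
  cyclically the three sectors of slopes t < 0, 0 < t < 1 and t > 1. They therefore have equal area,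
  and the middle one is the Beta integral, with exponents 1/3 - 1 = - 2/3.\<close>

lemma split_cubic_area:
  "emeasure lborel {(x :: real, y :: real). \<bar>x * y * (x - y)\<bar> \<le> 1} = ennreal (3 * Beta (1 / 3) (1 / 3))"
proof -
  define N where "N = (\<lambda>x y :: real. \<bar>x * y * (x - y)\<bar>)"
  have meas [measurable]: "(\<lambda>z. N (fst z) (snd z)) \<in> borel_measurable borel"
    unfolding N_def by measurable
  have hom: "N (s * x) (s * y) = \<bar>s\<bar> ^ 3 * N x y" for s x y
    unfolding N_def by (simp add: abs_mult power3_eq_cube flip: right_diff_distrib)
  have nonneg: "N x y \<ge> 0" for x y by (simp add: N_def)
  have nz: "AE t in lborel. N t 1 \<noteq> 0"
    using AE_lborel_singleton[of 0] AE_lborel_singleton[of 1] by eventually_elim (simp add: N_def)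
  note area = homogeneous_sector_area[OF meas zero_less_numeral hom nonneg nz]
  define S where "S = (\<lambda>E. {(x, y). N x y \<le> 1 \<and> x / y \<in> E})"
  have S [measurable]: "S E \<in> sets borel" if [measurable]: "E \<in> sets borel" for E
  proof -
    have "{z \<in> space borel. N (fst z) (snd z) \<le> 1 \<and> fst z / snd z \<in> E} \<in> sets borel"
      by measurable
    thus ?thesis by (simp add: S_def case_prod_beta)
  qed
  have rot: "emeasure lborel (S E) = emeasure lborel {(x, y). (y, y - x) \<in> S E}"
    if "E \<in> sets borel" for E
    using emeasure_linear_plane[OF S[OF that], of 0 1 1 "-1"] by simp
  have N_rot: "N y (y - x) = N x y" for x y
    by (simp add: N_def abs_mult abs_minus_commute)
  have slope1: "1 < y / (y - x) \<longleftrightarrow> 0 < x / y \<and> x / y < 1"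
    and slope2: "y / (y - x) < 0 \<longleftrightarrow> 1 < x / y" if "y \<noteq> 0" for x y :: real
  proof -
    have "y / (y - x) = inverse ((y - x) / y)" by simp
    also have "(y - x) / y = 1 - x / y" using that by (simp add: diff_divide_distrib)
    finally have *: "y / (y - x) = inverse (1 - x / y)" .
    show "1 < y / (y - x) \<longleftrightarrow> 0 < x / y \<and> x / y < 1" unfolding * one_less_inverse_iff by auto
    show "y / (y - x) < 0 \<longleftrightarrow> 1 < x / y" unfolding * by simp
  qed
  have E1: "{(x, y). (y, y - x) \<in> S {1<..}} = S {0<..<1}"
  proof -
    \<comment> \<open>For y = 0 both quotients are 0 by the convention for division, so both sides
      are false.\<close>
    have "1 < y / (y - x) \<longleftrightarrow> 0 < x / y \<and> x / y < 1" for x y :: real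
      by (cases "y = 0") (simp, rule slope1)
    thus ?thesis by (simp add: S_def N_rot)
  qed
  have E2: "{(x, y). (y, y - x) \<in> S {..<0}} = S {1<..}"
  proof -
    have "y / (y - x) < 0 \<longleftrightarrow> 1 < x / y" for x y :: real
      by (cases "y = 0") (simp, rule slope2)
    thus ?thesis by (simp add: S_def N_rot)
  qed
  define h where "h = (\<lambda>t. ennreal (N t 1 powr (- 2 / 3)))"
  have [measurable]: "h \<in> borel_measurable borel" unfolding h_def N_def by measurable
  have h: "emeasure lborel (S E) = (\<integral>\<^sup>+t. h t * indicator E t \<partial>lborel)" if "E \<in> sets borel" for E
    using area[OF that] by (simp add: h_def S_def)
  have "emeasure lborel {(x :: real, y :: real). \<bar>x * y * (x - y)\<bar> \<le> 1} = emeasure lborel (S UNIV)"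
    by (simp add: S_def N_def)
  also have "\<dots> = (\<integral>\<^sup>+t. h t * indicator UNIV t \<partial>lborel)" by (rule h) simp
  also have "\<dots> = (\<integral>\<^sup>+t. h t * indicator {0<..<1} t + h t * indicator {1<..} t + h t * indicator {..<0} t \<partial>lborel)"
  proof (rule nn_integral_cong_AE)
    show "AE t in lborel. h t * indicator UNIV t =
        h t * indicator {0<..<1} t + h t * indicator {1<..} t + h t * indicator {..<0} t"
      using AE_lborel_singleton[of 0] AE_lborel_singleton[of 1]
      by eventually_elim (auto split: split_indicator)
  qed
  also have "\<dots> = emeasure lborel (S {0<..<1}) + emeasure lborel (S {1<..}) + emeasure lborel (S {..<0})"
    by (subst (3 2 1) h) (auto simp: nn_integral_add)
  also have "emeasure lborel (S {..<0}) = emeasure lborel (S {1<..})"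
    using rot[of "{..<0}"] E2 by simp
  also have "emeasure lborel (S {1<..}) = emeasure lborel (S {0<..<1})"
    using rot[of "{1<..}"] E1 by simp
  also have "emeasure lborel (S {0<..<1}) = ennreal (Beta (1 / 3) (1 / 3))"
  proof -
    have "((\<lambda>t::real. t powr (1 / 3 - 1) * (1 - t) powr (1 / 3 - 1)) has_integral Beta (1 / 3) (1 / 3)) {0<..<1}"
      using has_integral_Beta_real[of "1/3" "1/3"] by (simp add: has_integral_Icc_iff_Ioo)
    from nn_integral_has_integral_lebesgue[OF _ this]
    have "(\<integral>\<^sup>+t. ennreal (indicator {0<..<1} t * (t powr (1 / 3 - 1) * (1 - t) powr (1 / 3 - 1))) \<partial>lborel) =
        ennreal (Beta (1 / 3) (1 / 3))"
      by (simp add: nn_integral_completion)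
    moreover have "(\<integral>\<^sup>+t. ennreal (indicator {0<..<1} t * (t powr (1 / 3 - 1) * (1 - t) powr (1 / 3 - 1))) \<partial>lborel) =
       (\<integral>\<^sup>+t. h t * indicator {0<..<1} t \<partial>lborel)"
      by (intro nn_integral_cong) (auto simp: h_def N_def abs_mult powr_mult split: split_indicator)
    ultimately show ?thesis by (simp add: h)
  qed
  finally have "emeasure lborel {(x :: real, y :: real). \<bar>x * y * (x - y)\<bar> \<le> 1} =
      ennreal (Beta (1 / 3) (1 / 3)) + ennreal (Beta (1 / 3) (1 / 3)) + ennreal (Beta (1 / 3) (1 / 3))" .
  moreover have "Beta (1 / 3) (1 / 3 :: real) \<ge> 0"
    by (simp add: Beta_def Gamma_real_pos less_imp_le)
  ultimately show ?thesis
    by (simp only: ennreal_plus[symmetric] add_nonneg_nonneg) (simp add: algebra_simps)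
qed

text \<open>The linear relation \<open>d\<^sub>2\<^sub>3 L\<^sub>1 - d\<^sub>1\<^sub>3 L\<^sub>2 + d\<^sub>1\<^sub>2 L\<^sub>3 = 0\<close> between three linear forms turns their product
  into \<open>X Y (X - Y)\<close> with \<open>X = d\<^sub>2\<^sub>3 L\<^sub>1\<close> and \<open>Y = d\<^sub>1\<^sub>3 L\<^sub>2\<close>.\<close>

lemma real_cubic_area:
  fixes u1 u2 u3 v1 v2 v3 :: real
  defines "d12 \<equiv> u1 * v2 - u2 * v1" and "d13 \<equiv> u1 * v3 - u3 * v1" and "d23 \<equiv> u2 * v3 - u3 * v2"
  assumes nz: "d12 \<noteq> 0" "d13 \<noteq> 0" "d23 \<noteq> 0"
  shows "ennreal (\<bar>d12 * d13 * d23\<bar> powr (1 / 3)) *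
    emeasure lborel {(x, y). \<bar>(u1 * x - v1 * y) * (u2 * x - v2 * y) * (u3 * x - v3 * y)\<bar> \<le> 1} =
    ennreal (3 * Beta (1 / 3) (1 / 3))"
proof -
  define D where "D = \<bar>d12 * d13 * d23\<bar>"
  define r where "r = D powr (1 / 3)"
  have "D > 0" using nz by (simp add: D_def)
  hence "r > 0" by (simp add: r_def)
  have r3: "r ^ 3 = D" using \<open>D > 0\<close> by (simp add: r_def powr_power)
  define S where "S = {(x, y). \<bar>x * y * (x - y) :: real\<bar> \<le> 1}"
  have S: "S \<in> sets borel"
    unfolding S_def case_prod_beta
    by (intro borel_closed closed_Collect_le continuous_intros)
  \<comment> \<open>The division by \<open>r\<close>, where r^3 = D, makes the new cubic agree with
    the old one up to sign and leaves the determinant with modulus D / r^2 = r.\<close>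
  let ?a = "d23 * u1 / r" and ?b = "- d23 * v1 / r" and ?c = "d13 * u2 / r" and ?d = "- d13 * v2 / r"
  have det: "?a * ?d - ?b * ?c = - (d12 * d13 * d23) / r\<^sup>2"
    using \<open>r > 0\<close> by (simp add: d12_def field_simps power2_eq_square)
  have abs_det: "\<bar>?a * ?d - ?b * ?c\<bar> = r"
    unfolding det using \<open>r > 0\<close> r3 by (simp add: D_def abs_divide field_simps power2_eq_square power3_eq_cube)
  have prod_eq: "(?a * x + ?b * y) * (?c * x + ?d * y) * ((?a * x + ?b * y) - (?c * x + ?d * y)) =
      - (d12 * d13 * d23) / r ^ 3 * ((u1 * x - v1 * y) * (u2 * x - v2 * y) * (u3 * x - v3 * y))" for x y
  proof -
    have "?a * x + ?b * y = d23 * (u1 * x - v1 * y) / r" "?c * x + ?d * y = d13 * (u2 * x - v2 * y) / r"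
      using \<open>r > 0\<close> by (simp_all add: field_simps)
    moreover have "d23 * (u1 * x - v1 * y) / r - d13 * (u2 * x - v2 * y) / r = - d12 * (u3 * x - v3 * y) / r"
      using \<open>r > 0\<close> by (simp add: d12_def d13_def d23_def field_simps)
    ultimately show ?thesis by (simp add: power3_eq_cube)
  qed
  have abs_eq: "\<bar>(?a * x + ?b * y) * (?c * x + ?d * y) * ((?a * x + ?b * y) - (?c * x + ?d * y))\<bar> =
     \<bar>(u1 * x - v1 * y) * (u2 * x - v2 * y) * (u3 * x - v3 * y)\<bar>" for x y
  proof -
    have "\<bar>- (d12 * d13 * d23) / r ^ 3\<bar> = 1"
      using \<open>D > 0\<close> unfolding r3 abs_divide abs_minus_cancel D_def[symmetric] by simp
    thus ?thesis by (simp only: prod_eq abs_mult[of "- (d12 * d13 * d23) / r ^ 3"] mult_1_left)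
  qed
  have "emeasure lborel S = ennreal r * emeasure lborel {(x, y). (?a * x + ?b * y, ?c * x + ?d * y) \<in> S}"
  proof -
    have "?a * ?d - ?b * ?c \<noteq> 0" using abs_det \<open>r > 0\<close> by (metis abs_zero less_irrefl)
    from emeasure_linear_plane[OF S this] show ?thesis unfolding abs_det .
  qed
  also have "{(x, y). (?a * x + ?b * y, ?c * x + ?d * y) \<in> S} =
      {(x, y). \<bar>(u1 * x - v1 * y) * (u2 * x - v2 * y) * (u3 * x - v3 * y)\<bar> \<le> 1}"
    unfolding S_def by (simp only: mem_Collect_eq case_prod_conv abs_eq)
  finally have "ennreal r * emeasure lborel {(x, y).
      \<bar>(u1 * x - v1 * y) * (u2 * x - v2 * y) * (u3 * x - v3 * y)\<bar> \<le> 1} = emeasure lborel S" ..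
  also have "\<dots> = ennreal (3 * Beta (1 / 3) (1 / 3))"
    unfolding S_def by (rule split_cubic_area)
  finally show ?thesis unfolding r_def D_def .
qed

section \<open>The normalised area as an integral; cubic forms\<close>

text \<open>The product runs over ordered pairs, so every pair of factors counts twice and the value
  is |D_F|. An arbitrary index set, without an order, lets subforms be written as
  \<open>I - {k}\<close>.\<close>

definition det_prod :: "'i set \<Rightarrow> ('i \<Rightarrow> complex) \<Rightarrow> ('i \<Rightarrow> complex) \<Rightarrow> real" where
  "det_prod I \<alpha> \<beta> = (\<Prod>i\<in>I. \<Prod>j\<in>I - {i}. cmod (\<alpha> i * \<beta> j - \<alpha> j * \<beta> i))"

definition lin_prod :: "'i set \<Rightarrow> ('i \<Rightarrow> complex) \<Rightarrow> ('i \<Rightarrow> complex) \<Rightarrow> real \<Rightarrow> real" where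
  "lin_prod I \<alpha> \<beta> t = (\<Prod>i\<in>I. cmod (\<alpha> i * of_real t - \<beta> i))"

text \<open>A factor enters 2 (n - 1) determinants with exponent 1 / (n (n - 1)) and one linear
  value with exponent - 2 / n, so the total degree in each factor is 0 and nonzero scalars
  cancel.\<close>

definition form_density :: "'i set \<Rightarrow> ('i \<Rightarrow> complex) \<Rightarrow> ('i \<Rightarrow> complex) \<Rightarrow> real \<Rightarrow> real" where
  "form_density I \<alpha> \<beta> t = det_prod I \<alpha> \<beta> powr (1 / (real (card I) * (real (card I) - 1))) *
     lin_prod I \<alpha> \<beta> t powr (- 2 / real (card I))"

text \<open>The normalised area \<open>|D\<^sub>F|\<^bsup>1/n(n-1)\<^esup> A\<^sub>F\<close> in the coordinate \<open>t = x / y\<close>; it is \<open>0\<close> when \<open>D\<^sub>F = 0\<close>.\<close>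

definition form_integral :: "'i set \<Rightarrow> ('i \<Rightarrow> complex) \<Rightarrow> ('i \<Rightarrow> complex) \<Rightarrow> ennreal" where
  "form_integral I \<alpha> \<beta> = (\<integral>\<^sup>+t. ennreal (form_density I \<alpha> \<beta> t) \<partial>lborel)"

lemma det_prod_nonneg [simp]: "det_prod I \<alpha> \<beta> \<ge> 0"
  by (simp add: det_prod_def prod_nonneg)

lemma lin_prod_nonneg [simp]: "lin_prod I \<alpha> \<beta> t \<ge> 0"
  by (simp add: lin_prod_def prod_nonneg)

lemma form_density_nonneg [simp]: "form_density I \<alpha> \<beta> t \<ge> 0"
  by (simp add: form_density_def)

lemma measurable_lin_prod [measurable]: "lin_prod I \<alpha> \<beta> \<in> borel_measurable borel"
  unfolding lin_prod_def by measurable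

lemma measurable_form_density [measurable]: "form_density I \<alpha> \<beta> \<in> borel_measurable borel"
  unfolding form_density_def by measurable

lemma det_prod_neq_0_iff:
  assumes "finite I"
  shows "det_prod I \<alpha> \<beta> \<noteq> 0 \<longleftrightarrow> (\<forall>i\<in>I. \<forall>j\<in>I. i \<noteq> j \<longrightarrow> \<alpha> i * \<beta> j \<noteq> \<alpha> j * \<beta> i)"
  using assms by (auto simp: det_prod_def)

lemma det_prod_cong:
  assumes "\<And>i. i \<in> I \<Longrightarrow> \<alpha> i = \<alpha>' i \<and> \<beta> i = \<beta>' i"
  shows "det_prod I \<alpha> \<beta> = det_prod I \<alpha>' \<beta>'"
  unfolding det_prod_def by (intro prod.cong) (use assms in auto)

lemma lin_prod_cong:
  assumes "\<And>i. i \<in> I \<Longrightarrow> \<alpha> i = \<alpha>' i \<and> \<beta> i = \<beta>' i"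
  shows "lin_prod I \<alpha> \<beta> t = lin_prod I \<alpha>' \<beta>' t"
  unfolding lin_prod_def by (intro prod.cong) (use assms in auto)

lemma det_prod_remove:
  assumes "finite I" "i \<in> I"
  shows "det_prod I \<alpha> \<beta> =
    det_prod (I - {i}) \<alpha> \<beta> * (\<Prod>j\<in>I - {i}. cmod (\<alpha> i * \<beta> j - \<alpha> j * \<beta> i))\<^sup>2"
proof -
  let ?d = "\<lambda>i j. cmod (\<alpha> i * \<beta> j - \<alpha> j * \<beta> i)"
  have "det_prod I \<alpha> \<beta> = (\<Prod>j\<in>I - {i}. ?d i j) * (\<Prod>k\<in>I - {i}. \<Prod>j\<in>I - {k}. ?d k j)"
    unfolding det_prod_def using assms by (rule prod.remove)
  also have "(\<Prod>k\<in>I - {i}. \<Prod>j\<in>I - {k}. ?d k j) = (\<Prod>k\<in>I - {i}. ?d i k * (\<Prod>j\<in>I - {i} - {k}. ?d k j))"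
  proof (rule prod.cong)
    fix k assume "k \<in> I - {i}"
    hence "(\<Prod>j\<in>I - {k}. ?d k j) = ?d k i * (\<Prod>j\<in>I - {k} - {i}. ?d k j)"
      using assms by (intro prod.remove) auto
    thus "(\<Prod>j\<in>I - {k}. ?d k j) = ?d i k * (\<Prod>j\<in>I - {i} - {k}. ?d k j)"
      by (simp add: norm_minus_commute Diff_insert2[symmetric] insert_commute)
  qed simp
  finally show ?thesis
    by (simp add: prod.distrib det_prod_def power2_eq_square mult_ac)
qed

lemma lin_prod_remove:
  assumes "finite I" "i \<in> I"
  shows "lin_prod I \<alpha> \<beta> t = cmod (\<alpha> i * of_real t - \<beta> i) * lin_prod (I - {i}) \<alpha> \<beta> t"
  unfolding lin_prod_def using assms by (rule prod.remove)

lemma power2_powr: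
  fixes x p :: real
  assumes "x \<ge> 0"
  shows "(x\<^sup>2) powr p = x powr (2 * p)"
  using assms powr_powr[of x 2 p] by (cases "x = 0") auto

text \<open>This isolates the dependence on one factor, in the shape required by
  \<open>circle_product_mean\<close>: determinants with a positive exponent, one linear value with a
  negative exponent, and a remainder free of \<open>a\<close> and \<open>b\<close>.\<close>

lemma form_density_update:
  fixes I \<alpha> \<beta> i t
  defines "n \<equiv> real (card I)"
  assumes "finite I" "i \<in> I"
  shows "form_density I (\<alpha>(i := a)) (\<beta>(i := b)) t =
    det_prod (I - {i}) \<alpha> \<beta> powr (1 / (n * (n - 1))) * lin_prod (I - {i}) \<alpha> \<beta> t powr (- 2 / n) *
    ((\<Prod>j\<in>I - {i}. cmod (a * \<beta> j - \<alpha> j * b)) powr (2 / (n * (n - 1))) *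
     cmod (a * of_real t - b) powr (- (2 / n)))"
proof -
  let ?\<alpha> = "\<alpha>(i := a)" and ?\<beta> = "\<beta>(i := b)"
  have "det_prod (I - {i}) ?\<alpha> ?\<beta> = det_prod (I - {i}) \<alpha> \<beta>"
    "lin_prod (I - {i}) ?\<alpha> ?\<beta> t = lin_prod (I - {i}) \<alpha> \<beta> t"
    by (intro det_prod_cong lin_prod_cong; simp)+
  moreover have "(\<Prod>j\<in>I - {i}. cmod (?\<alpha> i * ?\<beta> j - ?\<alpha> j * ?\<beta> i)) = (\<Prod>j\<in>I - {i}. cmod (a * \<beta> j - \<alpha> j * b))"
    by (intro prod.cong) auto
  ultimately have "det_prod I ?\<alpha> ?\<beta> = det_prod (I - {i}) \<alpha> \<beta> * (\<Prod>j\<in>I - {i}. cmod (a * \<beta> j - \<alpha> j * b))\<^sup>2"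
    "lin_prod I ?\<alpha> ?\<beta> t = cmod (a * of_real t - b) * lin_prod (I - {i}) \<alpha> \<beta> t"
    using det_prod_remove[OF assms(2,3), of ?\<alpha> ?\<beta>] lin_prod_remove[OF assms(2,3), of ?\<alpha> ?\<beta> t] by auto
  thus ?thesis
    by (simp add: form_density_def n_def powr_mult power2_powr prod_nonneg mult_ac)
qed

text \<open>The condition that a cnj b is real: an equation for being a complex multiple of a linear
  form with real coefficients (see \<open>real_form_scaled\<close>). The zero form is
  included.\<close>

definition real_form :: "complex \<Rightarrow> complex \<Rightarrow> bool" where
  "real_form a b \<longleftrightarrow> a * cnj b = cnj a * b"

text \<open>For \<open>|w| = 1\<close> the form \<open>L + w L'\<close>, with \<open>L'\<close> the conjugate of \<open>L\<close>, is proportional to a real one.\<close>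

lemma real_form_average:
  assumes "cmod w = 1"
  shows "real_form (a + w * cnj a) (b + w * cnj b)"
proof -
  have w: "w * cnj w = 1" using assms complex_norm_square[of w] by simp
  have "(a + w * cnj a) * cnj (b + w * cnj b) - cnj (a + w * cnj a) * (b + w * cnj b) =
      (w * cnj w - 1) * (cnj a * b - a * cnj b)"
    by (simp add: algebra_simps)
  thus ?thesis by (simp add: real_form_def w)
qed

lemma real_form_scaled:
  assumes "real_form a b"
  obtains c :: complex and u v :: real where "a = c * of_real u" "b = c * of_real v"
proof (cases "a = 0")
  case True
  thus ?thesis using that[of b 0 1] by simp
next
  case False
  have "cnj (b / a) = b / a"
    using assms False by (simp add: real_form_def field_simps)
  hence "b / a = of_real (Re (b / a))"
    by (simp add: complex_eq_iff del: complex_cnj_divide)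
  hence "b = a * of_real (Re (b / a))"
    using False by (metis nonzero_mult_div_cancel_left times_divide_eq_right)
  thus ?thesis using that[of a 1] by simp
qed

section \<open>Averaging one linear factor\<close>

lemma measurable_cnj [measurable]: "cnj \<in> borel_measurable borel"
  by (intro borel_measurable_continuous_onI continuous_intros)

text \<open>Every determinant involving factor \<open>i\<close> is affine in \<open>w\<close>, and
  since t is real its value at t becomes \<open>l t + w * cnj (l t)\<close>. At w = 0 the original
  form appears, so the mean over the circle compares it with forms whose factor \<open>i\<close> is
  real up to a scalar.\<close>

lemma form_density_average:
  fixes I :: "'i set" and \<alpha> \<beta> :: "'i \<Rightarrow> complex"
  assumes I: "finite I" "i \<in> I" "card I \<ge> 2"
  defines "A \<equiv> \<lambda>w. \<alpha>(i := \<alpha> i + w * cnj (\<alpha> i))" and "B \<equiv> \<lambda>w. \<beta>(i := \<beta> i + w * cnj (\<beta> i))"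
  shows "(\<lambda>(w, t). ennreal (form_density I (A w) (B w) t)) \<in> borel_measurable (circle_measure \<Otimes>\<^sub>M lborel)"
    and "ennreal (form_density I \<alpha> \<beta> t) \<le> (\<integral>\<^sup>+w. ennreal (form_density I (A w) (B w) t) \<partial>circle_measure)"
    and "\<lbrakk>det_prod I \<alpha> \<beta> \<noteq> 0; lin_prod I \<alpha> \<beta> t \<noteq> 0; \<not> real_form (\<alpha> i) (\<beta> i)\<rbrakk> \<Longrightarrow>
      ennreal (form_density I \<alpha> \<beta> t) < (\<integral>\<^sup>+w. ennreal (form_density I (A w) (B w) t) \<partial>circle_measure)"
proof -
  define n where "n = real (card I)"
  have n: "n \<ge> 2" using I by (simp add: n_def)
  define p where "p = 2 / (n * (n - 1))"
  define q where "q = 2 / n"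
  have pq: "p > 0" "q > 0" using n by (simp_all add: p_def q_def)
  define C where "C = (\<lambda>t. det_prod (I - {i}) \<alpha> \<beta> powr (1 / (n * (n - 1))) *
    lin_prod (I - {i}) \<alpha> \<beta> t powr (- 2 / n))"
  have [measurable]: "C \<in> borel_measurable borel" unfolding C_def by measurable
  define a where "a = (\<lambda>j. \<alpha> i * \<beta> j - \<alpha> j * \<beta> i)"
  define b where "b = (\<lambda>j. cnj (\<alpha> i) * \<beta> j - \<alpha> j * cnj (\<beta> i))"
  define l where "l = (\<lambda>t. \<alpha> i * of_real t - \<beta> i)"
  have [measurable]: "l \<in> borel_measurable borel" unfolding l_def by measurable
  define h where "h = (\<lambda>t w. (\<Prod>j\<in>I - {i}. cmod (a j + w * b j)) powr p * cmod (l t + w * cnj (l t)) powr (- q))"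
  have dens: "form_density I (A w) (B w) t = C t * h t w" for w t
  proof -
    have "(\<alpha> i + w * cnj (\<alpha> i)) * \<beta> j - \<alpha> j * (\<beta> i + w * cnj (\<beta> i)) = a j + w * b j" for j
      by (simp add: a_def b_def algebra_simps)
    moreover have "(\<alpha> i + w * cnj (\<alpha> i)) * of_real t - (\<beta> i + w * cnj (\<beta> i)) = l t + w * cnj (l t)"
      by (simp add: l_def algebra_simps)
    ultimately show ?thesis
      using form_density_update[OF I(1,2), of \<alpha> "\<alpha> i + w * cnj (\<alpha> i)" \<beta> "\<beta> i + w * cnj (\<beta> i)" t]
      by (simp only: A_def B_def C_def h_def p_def q_def n_def)
  qed
  have dens0: "form_density I \<alpha> \<beta> t = C t * h t 0" for t
    using dens[of 0 t] by (simp add: A_def B_def)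
  show "(\<lambda>(w, t). ennreal (form_density I (A w) (B w) t)) \<in> borel_measurable (circle_measure \<Otimes>\<^sub>M lborel)"
    unfolding dens h_def by measurable
  have C_nonneg: "C t \<ge> 0" for t by (simp add: C_def)
  have mean: "(\<integral>\<^sup>+w. ennreal (form_density I (A w) (B w) t) \<partial>circle_measure) =
      ennreal (C t) * (\<integral>\<^sup>+w. ennreal (h t w) \<partial>circle_measure)" for t
    unfolding dens ennreal_mult'[OF C_nonneg]
    by (rule nn_integral_cmult) (simp add: h_def)
  show "ennreal (form_density I \<alpha> \<beta> t) \<le> (\<integral>\<^sup>+w. ennreal (form_density I (A w) (B w) t) \<partial>circle_measure)"
  proof (cases "l t = 0 \<or> (\<exists>j\<in>I - {i}. a j = 0)")
    case True
    \<comment> \<open>Also at a real zero of the factor, where the true density has a pole: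
      \<open>0 powr x = 0\<close> makes it 0 there.\<close>
    hence "h t 0 = 0" using I(1) by (auto simp: h_def)
    thus ?thesis by (simp add: dens0)
  next
    case False
    have "ennreal (h t 0) \<le> (\<integral>\<^sup>+w. ennreal (h t w) \<partial>circle_measure)"
      unfolding h_def by (rule circle_product_mean(1)) (use I pq False in auto)
    thus ?thesis
      unfolding mean dens0 ennreal_mult'[OF C_nonneg] by (rule mult_left_mono) simp
  qed
  assume det: "det_prod I \<alpha> \<beta> \<noteq> 0" and lin: "lin_prod I \<alpha> \<beta> t \<noteq> 0" and nonreal: "\<not> real_form (\<alpha> i) (\<beta> i)"
  have a_nz: "a j \<noteq> 0" if "j \<in> I - {i}" for j
    using det that I by (auto simp: det_prod_neq_0_iff a_def)
  have l_nz: "\<alpha> j * of_real t - \<beta> j \<noteq> 0" if "j \<in> I" for j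
    using lin that I by (auto simp: lin_prod_def)
  have "ennreal (h t 0) < (\<integral>\<^sup>+w. ennreal (h t w) \<partial>circle_measure)"
    unfolding h_def
  proof (rule circle_product_mean(2))
    fix j assume j: "j \<in> I - {i}"
    \<comment> \<open>The quantity deciding strictness splits into a measure of the nonreality of
      L_i and the value of L_j at t; both are nonzero here.\<close>
    have "a j * cnj (l t) - l t * b j =
        (\<alpha> i * cnj (\<beta> i) - cnj (\<alpha> i) * \<beta> i) * (\<alpha> j * of_real t - \<beta> j)"
      by (simp add: a_def b_def l_def algebra_simps)
    also have "\<dots> \<noteq> 0" using nonreal l_nz[of j] j by (simp add: real_form_def)
    finally show "a j * cnj (l t) \<noteq> l t * b j" by simp
  qed (use I pq a_nz l_nz in \<open>auto simp: l_def\<close>)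
  moreover have "C t > 0"
  proof -
    have "det_prod (I - {i}) \<alpha> \<beta> \<noteq> 0" "lin_prod (I - {i}) \<alpha> \<beta> t \<noteq> 0"
      using det lin det_prod_remove[OF I(1,2)] lin_prod_remove[OF I(1,2)] by auto
    thus ?thesis by (simp add: C_def)
  qed
  ultimately show "ennreal (form_density I \<alpha> \<beta> t) <
      (\<integral>\<^sup>+w. ennreal (form_density I (A w) (B w) t) \<partial>circle_measure)"
    unfolding mean dens0 ennreal_mult'[OF C_nonneg]
    by (intro ennreal_mult_strict_left_mono) auto
qed

lemma nn_integral_form_density_average:
  fixes I :: "'i set" and \<alpha> \<beta> :: "'i \<Rightarrow> complex"
  assumes I: "finite I" "i \<in> I" "card I \<ge> 2"
  defines "A \<equiv> \<lambda>w. \<alpha>(i := \<alpha> i + w * cnj (\<alpha> i))" and "B \<equiv> \<lambda>w. \<beta>(i := \<beta> i + w * cnj (\<beta> i))"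
  shows "(\<integral>\<^sup>+t. \<integral>\<^sup>+w. ennreal (form_density I (A w) (B w) t) \<partial>circle_measure \<partial>lborel) =
    (\<integral>\<^sup>+w. form_integral I (A w) (B w) \<partial>circle_measure)"
proof -
  interpret pair_sigma_finite circle_measure "lborel :: real measure"
    by unfold_locales
  show ?thesis
    unfolding form_integral_def
    using form_density_average(1)[OF I, of \<alpha> \<beta>] unfolding A_def B_def
    by (intro Fubini')
qed

lemma form_integral_average_le:
  fixes I :: "'i set" and \<alpha> \<beta> :: "'i \<Rightarrow> complex"
  assumes I: "finite I" "i \<in> I" "card I \<ge> 2"
    and K: "\<And>w. cmod w = 1 \<Longrightarrow>
      form_integral I (\<alpha>(i := \<alpha> i + w * cnj (\<alpha> i))) (\<beta>(i := \<beta> i + w * cnj (\<beta> i))) \<le> K"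
  shows "(\<integral>\<^sup>+t. \<integral>\<^sup>+w. ennreal (form_density I (\<alpha>(i := \<alpha> i + w * cnj (\<alpha> i)))
    (\<beta>(i := \<beta> i + w * cnj (\<beta> i))) t) \<partial>circle_measure \<partial>lborel) \<le> K"
proof -
  have "(\<integral>\<^sup>+w. form_integral I (\<alpha>(i := \<alpha> i + w * cnj (\<alpha> i))) (\<beta>(i := \<beta> i + w * cnj (\<beta> i))) \<partial>circle_measure) \<le>
      (\<integral>\<^sup>+w. K \<partial>circle_measure)"
    by (rule nn_integral_mono_AE) (use AE_circle_measure_norm K in \<open>auto elim: eventually_mono\<close>)
  thus ?thesis
    unfolding nn_integral_form_density_average[OF I] by (simp add: circle.emeasure_space_1[simplified])
qed

section \<open>The bound for cubic forms\<close>

lemma AE_lin_neq_0: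
  assumes "a \<noteq> 0 \<or> b \<noteq> (0 :: complex)"
  shows "AE t in lborel. a * of_real t - b \<noteq> 0"
proof (cases "a = 0")
  case False
  show ?thesis
    using AE_lborel_singleton[of "Re (b / a)"]
  proof eventually_elim
    case (elim t)
    show ?case
    proof
      assume "a * of_real t - b = 0"
      hence "b / a = of_real t" using False by (simp add: field_simps)
      thus False using elim by simp
    qed
  qed
qed (use assms in auto)

lemma AE_lin_prod_neq_0:
  assumes "finite I" "card I \<ge> 2" "det_prod I \<alpha> \<beta> \<noteq> 0"
  shows "AE t in lborel. lin_prod I \<alpha> \<beta> t \<noteq> 0"
proof -
  have "AE t in lborel. \<forall>i\<in>I. \<alpha> i * of_real t - \<beta> i \<noteq> 0"
  proof (rule AE_finite_allI[OF assms(1)], rule AE_lin_neq_0)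
    fix i assume i: "i \<in> I"
    have "\<exists>j\<in>I. j \<noteq> i"
    proof (rule ccontr)
      assume "\<not> (\<exists>j\<in>I. j \<noteq> i)"
      hence "I \<subseteq> {i}" by auto
      hence "card I \<le> card {i}" by (rule card_mono[rotated]) simp
      thus False using assms(2) by simp
    qed
    thus "\<alpha> i \<noteq> 0 \<or> \<beta> i \<noteq> 0"
      using assms(1,3) i by (auto simp: det_prod_neq_0_iff)
  qed
  thus ?thesis
    by eventually_elim (use assms(1) in \<open>auto simp: lin_prod_def\<close>)
qed

text \<open>Writing each factor as a complex scalar times a real form, the scalars cancel because
  the density has degree 0 in each factor; what remains is the normalised area of a real
  cubic.\<close>

lemma cubic_form_integral_real:
  fixes I :: "'i set"
  assumes "card I = 3" and real: "\<And>i. i \<in> I \<Longrightarrow> real_form (\<alpha> i) (\<beta> i)"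
    and det: "det_prod I \<alpha> \<beta> \<noteq> 0"
  shows "form_integral I \<alpha> \<beta> = ennreal (3 * Beta (1 / 3) (1 / 3))"
proof -
  have fin: "finite I" using assms(1) card.infinite by fastforce
  obtain i j k where I: "I = {i, j, k}" and ijk: "i \<noteq> j" "i \<noteq> k" "j \<noteq> k"
    using assms(1) card_3_iff[of I] by blast
  obtain c1 and u1 v1 :: real where 1: "\<alpha> i = c1 * of_real u1" "\<beta> i = c1 * of_real v1"
    using real_form_scaled[OF real[of i]] I by auto
  obtain c2 and u2 v2 :: real where 2: "\<alpha> j = c2 * of_real u2" "\<beta> j = c2 * of_real v2"
    using real_form_scaled[OF real[of j]] I by auto
  obtain c3 and u3 v3 :: real where 3: "\<alpha> k = c3 * of_real u3" "\<beta> k = c3 * of_real v3"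
    using real_form_scaled[OF real[of k]] I by auto
  define d12 where "d12 = u1 * v2 - u2 * v1"
  define d13 where "d13 = u1 * v3 - u3 * v1"
  define d23 where "d23 = u2 * v3 - u3 * v2"
  have wedge: "cmod (c * of_real u * (c' * of_real v') - c' * of_real u' * (c * of_real v)) =
      cmod c * cmod c' * \<bar>u * v' - u' * v\<bar>" for c c' and u v u' v' :: real
  proof -
    have "c * of_real u * (c' * of_real v') - c' * of_real u' * (c * of_real v) =
        c * c' * of_real (u * v' - u' * v)" by (simp add: algebra_simps)
    thus ?thesis by (simp only: norm_mult norm_of_real)
  qed
  have lin: "cmod (c * of_real u * of_real t - c * of_real v) = cmod c * \<bar>u * t - v\<bar>" for c and u v t :: real
  proof -
    have "c * of_real u * of_real t - c * of_real v = c * of_real (u * t - v)" by (simp add: algebra_simps)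
    thus ?thesis by (simp only: norm_mult norm_of_real)
  qed
  define c where "c = cmod c1 * cmod c2 * cmod c3"
  have diffs: "I - {i} = {j, k}" "I - {j} = {i, k}" "I - {k} = {i, j}" using I ijk by auto
  have "det_prod I \<alpha> \<beta> = (\<Prod>x\<in>{i, j, k}. \<Prod>y\<in>I - {x}. cmod (\<alpha> x * \<beta> y - \<alpha> y * \<beta> x))"
    by (simp add: det_prod_def I)
  also have "\<dots> = (c\<^sup>2 * \<bar>d12 * d13 * d23\<bar>)\<^sup>2"
    using ijk by (simp add: diffs 1 2 3 wedge)
      (simp add: c_def d12_def d13_def d23_def abs_mult power2_eq_square abs_minus_commute mult_ac)
  finally have D: "det_prod I \<alpha> \<beta> = (c\<^sup>2 * \<bar>d12 * d13 * d23\<bar>)\<^sup>2" .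
  hence nz: "c \<noteq> 0" "d12 \<noteq> 0" "d13 \<noteq> 0" "d23 \<noteq> 0" using det by auto
  hence c_pos: "c > 0" by (simp add: c_def less_le)
  define N where "N = (\<lambda>x y. \<bar>(u1 * x - v1 * y) * (u2 * x - v2 * y) * (u3 * x - v3 * y)\<bar>)"
  have L: "lin_prod I \<alpha> \<beta> t = c * N t 1" for t
    using ijk by (simp add: lin_prod_def I 1 2 3 lin) (simp add: c_def N_def abs_mult mult_ac)
  have dens: "form_density I \<alpha> \<beta> t = \<bar>d12 * d13 * d23\<bar> powr (1 / 3) * N t 1 powr (- 2 / real 3)" for t
  proof -
    have "det_prod I \<alpha> \<beta> powr (1 / 6) = c powr (2 / 3) * \<bar>d12 * d13 * d23\<bar> powr (1 / 3)"
      unfolding D using c_pos by (simp add: power2_powr powr_mult)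
    moreover have "lin_prod I \<alpha> \<beta> t powr (- 2 / 3) = c powr (- (2 / 3)) * N t 1 powr (- 2 / 3)"
      unfolding L using c_pos by (simp add: powr_mult N_def)
    moreover have "c powr (2 / 3) * c powr (- (2 / 3)) = 1"
      using c_pos by (simp flip: powr_add)
    ultimately show ?thesis
      by (simp add: form_density_def assms(1))
  qed
  have "(\<integral>\<^sup>+t. ennreal (N t 1 powr (- 2 / real 3)) \<partial>lborel) = emeasure lborel {(x, y). N x y \<le> 1}"
  proof (rule homogeneous_area[symmetric])
    show "(\<lambda>z. N (fst z) (snd z)) \<in> borel_measurable borel"
      unfolding N_def by measurable
    show "N (s * x) (s * y) = \<bar>s\<bar> ^ 3 * N x y" for s x y
    proof -
      have "u * (s * x) - v * (s * y) = s * (u * x - v * y)" for u v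
        by (simp add: algebra_simps)
      thus ?thesis by (simp only: N_def abs_mult) (simp add: power3_eq_cube)
    qed
    show "AE t in lborel. N t 1 \<noteq> 0"
      using AE_lin_prod_neq_0[OF fin _ det] assms(1) L by (auto elim: eventually_mono)
  qed (simp_all add: N_def)
  thus ?thesis
    unfolding form_integral_def dens
    using real_cubic_area[of u1 v2 u2 v1 v3 u3] nz
    by (simp add: ennreal_mult' nn_integral_cmult N_def d12_def d13_def d23_def)
qed

lemma form_integral_degenerate: "det_prod I \<alpha> \<beta> = 0 \<Longrightarrow> form_integral I \<alpha> \<beta> = 0"
  by (simp add: form_integral_def form_density_def)

text \<open>Degenerate forms are included, with integral 0, since for some \<open>w\<close> the
  averaged factor may vanish or become proportional to another one.\<close>

lemma cubic_form_integral_le: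
  fixes I :: "'i set"
  assumes "card I = 3"
  shows "form_integral I \<alpha> \<beta> \<le> ennreal (3 * Beta (1 / 3) (1 / 3))"
proof -
  have fin: "finite I" using assms card.infinite by fastforce
  \<comment> \<open>\<open>J\<close> contains the indices whose factors may still be nonreal.
    Averaging factor \<open>i\<close> removes \<open>i\<close> from it, at the price of changing the
    form, hence the induction over arbitrary \<alpha> and \<beta>.\<close>
  have "form_integral I \<alpha> \<beta> \<le> ennreal (3 * Beta (1 / 3) (1 / 3))"
    if "finite J" "J \<subseteq> I" "\<And>i. i \<in> I - J \<Longrightarrow> real_form (\<alpha> i) (\<beta> i)" for J
    using that
  proof (induction J arbitrary: \<alpha> \<beta> rule: finite_induct)
    case empty
    thus ?case
      using cubic_form_integral_real[OF assms, of \<alpha> \<beta>] form_integral_degenerate[of I \<alpha> \<beta>]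
      by (cases "det_prod I \<alpha> \<beta> = 0") auto
  next
    case (insert i J)
    have i: "i \<in> I" and card: "card I \<ge> 2" using insert.prems assms by auto
    have "form_integral I \<alpha> \<beta> \<le> (\<integral>\<^sup>+t. \<integral>\<^sup>+w. ennreal (form_density I (\<alpha>(i := \<alpha> i + w * cnj (\<alpha> i)))
        (\<beta>(i := \<beta> i + w * cnj (\<beta> i))) t) \<partial>circle_measure \<partial>lborel)"
      unfolding form_integral_def
      by (intro nn_integral_mono form_density_average(2)[OF fin i card])
    also have "\<dots> \<le> ennreal (3 * Beta (1 / 3) (1 / 3))"
    proof (rule form_integral_average_le[OF fin i card], rule insert.IH)
      show "J \<subseteq> I" using insert.prems by auto
      fix w :: complex and j assume "cmod w = 1" "j \<in> I - J"
      thus "real_form ((\<alpha>(i := \<alpha> i + w * cnj (\<alpha> i))) j) ((\<beta>(i := \<beta> i + w * cnj (\<beta> i))) j)"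
        using real_form_average insert.prems(2)[of j] by auto
    qed
    finally show ?case .
  qed
  from this[OF fin] show ?thesis by simp
qed

text \<open>Averaging the nonreal factor once is strict at almost every t, and the averaged forms
  obey the general bound. Finiteness of the integral, also from that bound, carries the strictness
  over to the integrals.\<close>

lemma cubic_form_integral_less:
  fixes I :: "'i set"
  assumes "card I = 3" "i \<in> I" and nonreal: "\<not> real_form (\<alpha> i) (\<beta> i)"
    and det: "det_prod I \<alpha> \<beta> \<noteq> 0"
  shows "form_integral I \<alpha> \<beta> < ennreal (3 * Beta (1 / 3) (1 / 3))"
proof -
  have fin: "finite I" using assms card.infinite by fastforce
  have card: "card I \<ge> 2" using assms by simp
  define g where "g = (\<lambda>t. \<integral>\<^sup>+w. ennreal (form_density I (\<alpha>(i := \<alpha> i + w * cnj (\<alpha> i)))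
        (\<beta>(i := \<beta> i + w * cnj (\<beta> i))) t) \<partial>circle_measure)"
  have [measurable]: "g \<in> borel_measurable borel"
    using circle.borel_measurable_nn_integral_fst[OF measurable_pair_swap[OF
          form_density_average(1)[OF fin assms(2) card, of \<alpha> \<beta>]]]
    by (simp add: g_def)
  have less: "AE t in lborel. ennreal (form_density I \<alpha> \<beta> t) < g t"
    using AE_lin_prod_neq_0[OF fin card det]
    by eventually_elim (use form_density_average(3)[OF fin assms(2) card det _ nonreal] in \<open>simp add: g_def\<close>)
  have "form_integral I \<alpha> \<beta> < (\<integral>\<^sup>+t. g t \<partial>lborel)"
    unfolding form_integral_def
  proof (rule nn_integral_less)
    show "(\<integral>\<^sup>+t. ennreal (form_density I \<alpha> \<beta> t) \<partial>lborel) \<noteq> \<infinity>"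
      using cubic_form_integral_le[OF assms(1), of \<alpha> \<beta>] unfolding form_integral_def
      by (auto simp: top_unique)
    show "AE t in lborel. ennreal (form_density I \<alpha> \<beta> t) \<le> g t"
      using less by eventually_elim simp
    show "\<not> (AE t in lborel. g t \<le> ennreal (form_density I \<alpha> \<beta> t))"
    proof
      assume "AE t in lborel. g t \<le> ennreal (form_density I \<alpha> \<beta> t)"
      with less have "AE t in (lborel :: real measure). False"
        by eventually_elim (simp add: not_le)
      thus False by (simp add: eventually_False ae_filter_eq_bot_iff)
    qed
  qed measurable
  also have "\<dots> \<le> ennreal (3 * Beta (1 / 3) (1 / 3))"
    unfolding g_def
    by (rule form_integral_average_le[OF fin assms(2) card], rule cubic_form_integral_le[OF assms(1)])
  finally show ?thesis .
qed

section \<open>Forms of higher degree\<close>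

text \<open>The terms x - 1 - ln x are nonnegative and vanish only at x = 1. For x = g k / D the
  logarithms cancel, as \<open>D\<close> is the geometric mean, so the sum of these terms is exactly
  the defect of the inequality.\<close>

lemma arith_geo_mean_exact:
  fixes g :: "'k \<Rightarrow> real"
  assumes "finite I" and pos: "\<And>k. k \<in> I \<Longrightarrow> g k > 0" "D > 0" and D: "D ^ card I = (\<Prod>k\<in>I. g k)"
  shows "real (card I) * D \<le> (\<Sum>k\<in>I. g k)"
    and "\<lbrakk>real (card I) * D = (\<Sum>k\<in>I. g k); k \<in> I\<rbrakk> \<Longrightarrow> g k = D"
proof -
  define e where "e = (\<lambda>k. g k / D - 1 - ln (g k / D))"
  have e_nonneg: "e k \<ge> 0" if "k \<in> I" for k
    using ln_le_minus_one[of "g k / D"] pos that by (simp add: e_def)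
  have "(\<Sum>k\<in>I. ln (g k / D)) = ln (\<Prod>k\<in>I. g k / D)"
    using assms(1) pos(2) by (intro ln_prod[symmetric]) (auto dest: pos(1))
  also have "(\<Prod>k\<in>I. g k / D) = 1"
    using D pos(2) by (simp add: prod_dividef flip: D)
  finally have sum_e: "(\<Sum>k\<in>I. e k) = (\<Sum>k\<in>I. g k) / D - real (card I)"
    by (simp add: e_def sum_subtractf flip: sum_divide_distrib)
  moreover have "(\<Sum>k\<in>I. e k) \<ge> 0" by (rule sum_nonneg) (rule e_nonneg)
  ultimately have "real (card I) \<le> (\<Sum>k\<in>I. g k) / D" by simp
  thus "real (card I) * D \<le> (\<Sum>k\<in>I. g k)"
    using pos(2) by (simp add: pos_le_divide_eq)
  assume eq: "real (card I) * D = (\<Sum>k\<in>I. g k)" and k: "k \<in> I"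
  have "(\<Sum>k\<in>I. e k) = 0"
    unfolding sum_e eq[symmetric] using pos(2) by simp
  hence "e k = 0" using assms(1) e_nonneg k by (simp add: sum_nonneg_eq_0_iff)
  hence "g k / D = 1" using pos k by (intro ln_eq_minus_one) (auto simp: e_def)
  thus "g k = D" using pos(2) by simp
qed

text \<open>Each pair of factors survives the removal of n - 2 of the n indices.\<close>

lemma prod_det_prod_remove:
  assumes "finite I" "card I \<ge> 2" "det_prod I \<alpha> \<beta> \<noteq> 0"
  shows "(\<Prod>k\<in>I. det_prod (I - {k}) \<alpha> \<beta>) = det_prod I \<alpha> \<beta> ^ (card I - 2)"
proof -
  let ?Q = "\<lambda>k. \<Prod>j\<in>I - {k}. cmod (\<alpha> k * \<beta> j - \<alpha> j * \<beta> k)"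
  have "det_prod I \<alpha> \<beta> ^ card I = (\<Prod>k\<in>I. det_prod I \<alpha> \<beta>)" by simp
  also have "\<dots> = (\<Prod>k\<in>I. det_prod (I - {k}) \<alpha> \<beta> * (?Q k)\<^sup>2)"
    by (rule prod.cong) (use det_prod_remove[OF assms(1)] in auto)
  also have "\<dots> = (\<Prod>k\<in>I. det_prod (I - {k}) \<alpha> \<beta>) * (det_prod I \<alpha> \<beta>)\<^sup>2"
    by (simp add: prod.distrib prod_power_distrib[symmetric] det_prod_def)
  finally have "(\<Prod>k\<in>I. det_prod (I - {k}) \<alpha> \<beta>) * (det_prod I \<alpha> \<beta>)\<^sup>2 =
      det_prod I \<alpha> \<beta> ^ (card I - 2) * (det_prod I \<alpha> \<beta>)\<^sup>2"
    using assms(2) by (metis le_add_diff_inverse2 power_add)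
  thus ?thesis using assms(3) by simp
qed

text \<open>Each factor survives the removal of n - 1 of the n indices.\<close>

lemma prod_lin_prod_remove:
  assumes "finite I" "card I \<ge> 1" "lin_prod I \<alpha> \<beta> t \<noteq> 0"
  shows "(\<Prod>k\<in>I. lin_prod (I - {k}) \<alpha> \<beta> t) = lin_prod I \<alpha> \<beta> t ^ (card I - 1)"
proof -
  have "lin_prod I \<alpha> \<beta> t ^ card I = (\<Prod>k\<in>I. lin_prod I \<alpha> \<beta> t)" by simp
  also have "\<dots> = (\<Prod>k\<in>I. cmod (\<alpha> k * of_real t - \<beta> k) * lin_prod (I - {k}) \<alpha> \<beta> t)"
    by (rule prod.cong) (use lin_prod_remove[OF assms(1)] in auto)
  also have "\<dots> = (\<Prod>k\<in>I. lin_prod (I - {k}) \<alpha> \<beta> t) * lin_prod I \<alpha> \<beta> t"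
    by (simp add: prod.distrib lin_prod_def)
  finally have "(\<Prod>k\<in>I. lin_prod (I - {k}) \<alpha> \<beta> t) * lin_prod I \<alpha> \<beta> t =
      lin_prod I \<alpha> \<beta> t ^ (card I - 1) * lin_prod I \<alpha> \<beta> t"
    using assms(2) power_add[of "lin_prod I \<alpha> \<beta> t" "card I - 1" 1] by simp
  thus ?thesis using assms(3) by simp
qed

text \<open>The counts n - 2 and n - 1 cancel against the exponents in degree n - 1: the
  discriminant gets the power 1 / (n - 1) and the form the power - 2, which are n times the
  exponents in degree n.\<close>

lemma form_density_power:
  assumes "finite I" "card I \<ge> 3" "det_prod I \<alpha> \<beta> \<noteq> 0" "lin_prod I \<alpha> \<beta> t \<noteq> 0"
  shows "form_density I \<alpha> \<beta> t ^ card I = (\<Prod>k\<in>I. form_density (I - {k}) \<alpha> \<beta> t)"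
proof -
  define x where "x = det_prod I \<alpha> \<beta>"
  define y where "y = lin_prod I \<alpha> \<beta> t"
  define n where "n = card I"
  have xy: "x > 0" "y > 0"
    using assms det_prod_nonneg[of I \<alpha> \<beta>] lin_prod_nonneg[of I \<alpha> \<beta> t] by (simp_all add: x_def y_def less_le)
  have n: "n \<ge> 3" using assms by (simp add: n_def)
  define a where "a = 1 / ((real n - 1) * (real n - 2))"
  define b where "b = - 2 / (real n - 1)"
  have "(\<Prod>k\<in>I. form_density (I - {k}) \<alpha> \<beta> t) =
      (\<Prod>k\<in>I. det_prod (I - {k}) \<alpha> \<beta> powr a * lin_prod (I - {k}) \<alpha> \<beta> t powr b)"
    by (rule prod.cong) (use assms n in \<open>auto simp: form_density_def a_def b_def n_def of_nat_diff algebra_simps\<close>)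
  also have "\<dots> = (\<Prod>k\<in>I. det_prod (I - {k}) \<alpha> \<beta>) powr a * (\<Prod>k\<in>I. lin_prod (I - {k}) \<alpha> \<beta> t) powr b"
    by (simp add: prod.distrib prod_powr_distrib)
  also have "\<dots> = (x ^ (n - 2)) powr a * (y ^ (n - 1)) powr b"
    using assms by (simp add: prod_det_prod_remove prod_lin_prod_remove x_def y_def n_def)
  also have "\<dots> = (x powr (real n - 2)) powr a * (y powr (real n - 1)) powr b"
    using xy n by (simp add: of_nat_diff flip: powr_realpow)
  also have "\<dots> = x powr (1 / (real n - 1)) * y powr (- 2)"
  proof -
    have "(real n - 2) * a = 1 / (real n - 1)"
      using n by (simp add: a_def)
    moreover have "(real n - 1) * b = - 2"
      using n by (simp add: b_def field_simps)
    ultimately show ?thesis unfolding powr_powr by simp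
  qed
  finally have rhs: "(\<Prod>k\<in>I. form_density (I - {k}) \<alpha> \<beta> t) = x powr (1 / (real n - 1)) * y powr (- 2)" .
  have "form_density I \<alpha> \<beta> t ^ n = (x powr (1 / (real n * (real n - 1)))) ^ n * (y powr (- 2 / real n)) ^ n"
    by (simp add: form_density_def x_def y_def n_def power_mult_distrib)
  also have "(x powr (1 / (real n * (real n - 1)))) ^ n = x powr (real n * (1 / (real n * (real n - 1))))"
    using xy by (intro powr_power) auto
  also have "(y powr (- 2 / real n)) ^ n = y powr (real n * (- 2 / real n))"
    using xy by (intro powr_power) auto
  finally show ?thesis
    unfolding rhs using n by (simp add: n_def[symmetric])
qed

lemma form_density_pos:
  "\<lbrakk>det_prod I \<alpha> \<beta> \<noteq> 0; lin_prod I \<alpha> \<beta> t \<noteq> 0\<rbrakk> \<Longrightarrow> form_density I \<alpha> \<beta> t > 0"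
  by (simp add: form_density_def)

lemma form_density_mean:
  assumes "finite I" "card I \<ge> 3" "det_prod I \<alpha> \<beta> \<noteq> 0" "lin_prod I \<alpha> \<beta> t \<noteq> 0"
  shows "real (card I) * form_density I \<alpha> \<beta> t \<le> (\<Sum>k\<in>I. form_density (I - {k}) \<alpha> \<beta> t)"
    and "\<lbrakk>real (card I) * form_density I \<alpha> \<beta> t = (\<Sum>k\<in>I. form_density (I - {k}) \<alpha> \<beta> t); k \<in> I\<rbrakk> \<Longrightarrow>
      form_density (I - {k}) \<alpha> \<beta> t = form_density I \<alpha> \<beta> t"
proof -
  have "form_density (I - {k}) \<alpha> \<beta> t > 0" if "k \<in> I" for k
    using assms det_prod_remove[OF assms(1) that] lin_prod_remove[OF assms(1) that]
    by (intro form_density_pos) auto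
  note * = arith_geo_mean_exact[OF assms(1) this form_density_pos[OF assms(3,4)] form_density_power[OF assms]]
  show "real (card I) * form_density I \<alpha> \<beta> t \<le> (\<Sum>k\<in>I. form_density (I - {k}) \<alpha> \<beta> t)"
    by (rule *(1))
  show "\<lbrakk>real (card I) * form_density I \<alpha> \<beta> t = (\<Sum>k\<in>I. form_density (I - {k}) \<alpha> \<beta> t); k \<in> I\<rbrakk> \<Longrightarrow>
      form_density (I - {k}) \<alpha> \<beta> t = form_density I \<alpha> \<beta> t"
    by (rule *(2))
qed

lemma card_mult_form_integral:
  "ennreal (real (card I)) * form_integral I \<alpha> \<beta> =
    (\<integral>\<^sup>+t. ennreal (real (card I) * form_density I \<alpha> \<beta> t) \<partial>lborel)"
  unfolding form_integral_def by (subst nn_integral_cmult[symmetric]) (auto simp: ennreal_mult')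

lemma sum_form_integral:
  "(\<Sum>k\<in>I. form_integral (I - {k}) \<alpha> \<beta>) =
    (\<integral>\<^sup>+t. ennreal (\<Sum>k\<in>I. form_density (I - {k}) \<alpha> \<beta> t) \<partial>lborel)"
  unfolding form_integral_def
  by (subst nn_integral_sum[symmetric]) (auto simp: sum_ennreal)

lemma form_integral_mean:
  assumes "finite I" "card I \<ge> 3" "det_prod I \<alpha> \<beta> \<noteq> 0"
  shows "ennreal (real (card I)) * form_integral I \<alpha> \<beta> \<le> (\<Sum>k\<in>I. form_integral (I - {k}) \<alpha> \<beta>)"
  unfolding card_mult_form_integral sum_form_integral
proof (rule nn_integral_mono_AE)
  have "card I \<ge> 2" using assms by simp
  from AE_lin_prod_neq_0[OF assms(1) this assms(3)]
  show "AE t in lborel. ennreal (real (card I) * form_density I \<alpha> \<beta> t) \<le>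
      ennreal (\<Sum>k\<in>I. form_density (I - {k}) \<alpha> \<beta> t)"
    by eventually_elim (use form_density_mean(1)[OF assms] in \<open>auto intro: ennreal_leI\<close>)
qed

text \<open>At a real zero \<open>r\<close> of \<open>L\<^sub>i\<close> the densities of \<open>I - {k}\<close> (\<open>k \<noteq> i\<close>) blow up and the one of
  \<open>I - {i}\<close> does not, so they are not almost everywhere equal.\<close>

lemma form_integral_mean_strict:
  fixes r :: real
  assumes I: "finite I" "card I \<ge> 3" and det: "det_prod I \<alpha> \<beta> \<noteq> 0"
    and i: "i \<in> I" "\<alpha> i * of_real r = \<beta> i" and finite: "form_integral I \<alpha> \<beta> \<noteq> \<infinity>"
  shows "ennreal (real (card I)) * form_integral I \<alpha> \<beta> < (\<Sum>k\<in>I. form_integral (I - {k}) \<alpha> \<beta>)"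
  unfolding card_mult_form_integral sum_form_integral
proof (rule nn_integral_less)
  have AE: "AE t in lborel. lin_prod I \<alpha> \<beta> t \<noteq> 0"
    using I det by (intro AE_lin_prod_neq_0) auto
  from AE show "AE t in lborel. ennreal (real (card I) * form_density I \<alpha> \<beta> t) \<le>
      ennreal (\<Sum>k\<in>I. form_density (I - {k}) \<alpha> \<beta> t)"
    by eventually_elim (use form_density_mean(1)[OF I det] in \<open>auto intro: ennreal_leI\<close>)
  show "(\<integral>\<^sup>+t. ennreal (real (card I) * form_density I \<alpha> \<beta> t) \<partial>lborel) \<noteq> \<infinity>"
    unfolding card_mult_form_integral[symmetric] using finite by (simp add: ennreal_mult_eq_top_iff)
  have "\<exists>k\<in>I. k \<noteq> i"
  proof (rule ccontr)
    assume "\<not> (\<exists>k\<in>I. k \<noteq> i)"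
    hence "I \<subseteq> {i}" by auto
    hence "card I \<le> card {i}" by (rule card_mono[rotated]) simp
    thus False using I(2) by simp
  qed
  then obtain k where k: "k \<in> I" "k \<noteq> i" by blast
  define e where "e = 2 / (real (card I) - 1)"
  have "e > 0" using I by (simp add: e_def)
  define c where "c = (\<lambda>k. det_prod (I - {k}) \<alpha> \<beta> powr (1 / ((real (card I) - 1) * (real (card I) - 2))))"
  have c_pos: "c k > 0" if "k \<in> I" for k
    using det det_prod_remove[OF I(1) that] by (simp add: c_def)
  have dens: "form_density (I - {k}) \<alpha> \<beta> t = c k * lin_prod (I - {k}) \<alpha> \<beta> t powr (- e)" if "k \<in> I" for k t
    using that I by (simp add: form_density_def c_def e_def of_nat_diff algebra_simps)
  \<comment> \<open>The equality of the two densities with the negative powers cleared. This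
    condition is closed, so it passes from almost every t to the pole \<open>r\<close> itself, where
    the densities as defined are 0 and carry no information.\<close>
  define C where "C = {t. c i * lin_prod (I - {k}) \<alpha> \<beta> t powr e = c k * lin_prod (I - {i}) \<alpha> \<beta> t powr e}"
  show "\<not> (AE t in lborel. ennreal (\<Sum>k\<in>I. form_density (I - {k}) \<alpha> \<beta> t) \<le>
      ennreal (real (card I) * form_density I \<alpha> \<beta> t))"
  proof
    assume "AE t in lborel. ennreal (\<Sum>k\<in>I. form_density (I - {k}) \<alpha> \<beta> t) \<le>
      ennreal (real (card I) * form_density I \<alpha> \<beta> t)"
    with AE have "AE t in lborel. t \<in> C"
    proof eventually_elim
      case (elim t)
      have "(\<Sum>k\<in>I. form_density (I - {k}) \<alpha> \<beta> t) \<le> real (card I) * form_density I \<alpha> \<beta> t"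
        using elim by (subst (asm) ennreal_le_iff) auto
      hence "real (card I) * form_density I \<alpha> \<beta> t = (\<Sum>k\<in>I. form_density (I - {k}) \<alpha> \<beta> t)"
        using form_density_mean(1)[OF I det elim(1)] by simp
      from form_density_mean(2)[OF I det elim(1) this]
      have "form_density (I - {i}) \<alpha> \<beta> t = form_density (I - {k}) \<alpha> \<beta> t" using i k by simp
      moreover have "lin_prod (I - {i}) \<alpha> \<beta> t \<noteq> 0" "lin_prod (I - {k}) \<alpha> \<beta> t \<noteq> 0"
        using elim(1) lin_prod_remove[OF I(1) i(1), of \<alpha> \<beta> t]
          lin_prod_remove[OF I(1) k(1), of \<alpha> \<beta> t] by auto
      ultimately show ?case
        using i k by (auto simp: dens powr_minus C_def field_simps)
    qed
    hence "AE t in lebesgue. t \<in> C" by (rule AE_completion)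
    moreover have "closed C"
    proof -
      have "continuous_on UNIV (\<lambda>t. lin_prod J \<alpha> \<beta> t powr e)" for J
        by (rule continuous_on_powr') (use \<open>e > 0\<close> in \<open>auto simp: lin_prod_def intro!: continuous_intros prod_nonneg\<close>)
      thus ?thesis
        unfolding C_def by (intro closed_Collect_eq continuous_on_mult continuous_on_const) auto
    qed
    ultimately have "r \<in> C" using mem_closed_if_AE_lebesgue by blast
    moreover have "lin_prod (I - {k}) \<alpha> \<beta> r = 0"
      using i k I by (auto simp: lin_prod_def)
    ultimately have "lin_prod (I - {i}) \<alpha> \<beta> r = 0"
      using c_pos[OF k(1)] by (simp add: C_def)
    then obtain j where j: "j \<in> I" "j \<noteq> i" "\<alpha> j * of_real r = \<beta> j"
      using I by (auto simp: lin_prod_def)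
    \<comment> \<open>A second factor vanishing at \<open>r\<close> would be proportional to
      L_i.\<close>
    have "\<alpha> i * \<beta> j = \<alpha> j * \<beta> i"
      unfolding i(2)[symmetric] j(3)[symmetric] by simp
    thus False using det i j I by (auto simp: det_prod_neq_0_iff)
  qed
qed measurable

lemma form_integral_le:
  fixes I :: "'i set"
  assumes "card I \<ge> 3"
  shows "form_integral I \<alpha> \<beta> \<le> ennreal (3 * Beta (1 / 3) (1 / 3))"
  using assms
proof (induction "card I" arbitrary: I rule: less_induct)
  case less
  have fin: "finite I" using less.prems card.infinite by fastforce
  show ?case
  proof (cases "card I = 3 \<or> det_prod I \<alpha> \<beta> = 0")
    case True
    thus ?thesis using cubic_form_integral_le form_integral_degenerate by fastforce
  next
    case False
    have "ennreal (real (card I)) * form_integral I \<alpha> \<beta> \<le> (\<Sum>k\<in>I. form_integral (I - {k}) \<alpha> \<beta>)"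
      using False less.prems fin by (intro form_integral_mean) auto
    also have "\<dots> \<le> (\<Sum>k\<in>I. ennreal (3 * Beta (1 / 3) (1 / 3)))"
    proof (rule sum_mono, rule less.hyps)
      fix k assume "k \<in> I"
      thus "card (I - {k}) < card I" "3 \<le> card (I - {k})"
        using fin False less.prems by auto
    qed
    also have "\<dots> = ennreal (real (card I)) * ennreal (3 * Beta (1 / 3) (1 / 3))"
      by (simp add: ennreal_of_nat_eq_real_of_nat)
    finally show ?thesis
      using less.prems by (subst (asm) ennreal_mult_le_mult_iff) auto
  qed
qed

lemma mean_less_bound:
  fixes K :: real and x :: ennreal and f :: "'i \<Rightarrow> ennreal"
  assumes "finite I" and mean: "ennreal (real (card I)) * x \<le> (\<Sum>k\<in>I. f k)"
    and le: "\<And>k. k \<in> I \<Longrightarrow> f k \<le> ennreal K" and strict: "i \<in> I" "f i < ennreal K"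
  shows "x < ennreal K"
proof (rule ccontr)
  assume "\<not> x < ennreal K"
  hence "ennreal (real (card I)) * ennreal K \<le> (\<Sum>k\<in>I. f k)"
    using mean by (meson mult_left_mono not_le order.trans zero_le)
  also have "\<dots> = f i + (\<Sum>k\<in>I - {i}. f k)"
    using assms by (intro sum.remove) auto
  also have "\<dots> \<le> f i + (\<Sum>k\<in>I - {i}. ennreal K)"
    using le by (intro add_left_mono sum_mono) auto
  \<comment> \<open>Strictness survives the addition because the other terms are finite.\<close>
  also have "\<dots> < ennreal K + (\<Sum>k\<in>I - {i}. ennreal K)"
    using strict(2) by (simp add: ennreal_add_left_cancel_less add.commute[of _ "of_nat _ * _"] ennreal_mult_eq_top_iff)
  also have "\<dots> = (\<Sum>k\<in>I. ennreal K)"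
    using assms by (intro sum.remove[symmetric]) auto
  also have "\<dots> = ennreal (real (card I)) * ennreal K"
    by (simp add: ennreal_of_nat_eq_real_of_nat)
  finally show False by simp
qed

text \<open>Above degree 4 some subform is strict by induction. In degree 4 a nonreal factor is kept
  by removing another index, which leaves a strict cubic. If all factors are real, the subforms may
  all be extremal, and the strictness comes from the arithmetic-geometric mean inequality.\<close>

lemma form_integral_less:
  fixes I :: "'i set"
  assumes "card I \<ge> 4" "det_prod I \<alpha> \<beta> \<noteq> 0"
  shows "form_integral I \<alpha> \<beta> < ennreal (3 * Beta (1 / 3) (1 / 3))"
  using assms
proof (induction "card I" arbitrary: I rule: less_induct)
  case less
  have fin: "finite I" using less.prems card.infinite by fastforce
  have card: "card I \<ge> 3" using less.prems by simp
  have card_remove: "card (I - {k}) = card I - 1" if "k \<in> I" for k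
    using fin that by simp
  have le: "form_integral (I - {k}) \<alpha> \<beta> \<le> ennreal (3 * Beta (1 / 3) (1 / 3))" if "k \<in> I" for k
    using less.prems that by (intro form_integral_le) (simp add: card_remove)
  have det: "det_prod (I - {k}) \<alpha> \<beta> \<noteq> 0" if "k \<in> I" for k
    using less.prems(2) det_prod_remove[OF fin that] by auto
  note mean = form_integral_mean[OF fin card less.prems(2)]
  obtain i j where ij: "i \<in> I" "j \<in> I" "i \<noteq> j"
    using card fin card_le_Suc0_iff_eq[of I] by auto
  consider "card I > 4" | "card I = 4" "\<exists>i\<in>I. \<not> real_form (\<alpha> i) (\<beta> i)"
    | "\<And>i. i \<in> I \<Longrightarrow> real_form (\<alpha> i) (\<beta> i)"
    using less.prems(1) by fastforce
  thus ?case
  proof cases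
    case 1
    have "form_integral (I - {i}) \<alpha> \<beta> < ennreal (3 * Beta (1 / 3) (1 / 3))"
      using 1 ij fin det by (intro less.hyps) (auto simp: card_remove)
    from mean_less_bound[OF fin mean le ij(1) this] show ?thesis .
  next
    case 2
    then obtain l where l: "l \<in> I" "\<not> real_form (\<alpha> l) (\<beta> l)" by blast
    obtain k where k: "k \<in> I" "k \<noteq> l" using ij by blast
    have "form_integral (I - {k}) \<alpha> \<beta> < ennreal (3 * Beta (1 / 3) (1 / 3))"
      using 2 k l det by (intro cubic_form_integral_less[of _ l]) (auto simp: card_remove)
    from mean_less_bound[OF fin mean le k(1) this] show ?thesis .
  next
    case 3
    \<comment> \<open>The coordinate t misses the zero at infinity. Two factors both having it would
      be proportional, so one of two factors has a finite zero, which is real here.\<close>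
    have "\<alpha> i \<noteq> 0 \<or> \<alpha> j \<noteq> 0"
      using less.prems(2) fin ij by (auto simp: det_prod_neq_0_iff)
    then obtain k where k: "k \<in> I" "\<alpha> k \<noteq> 0" using ij by blast
    obtain c and u v :: real where cuv: "\<alpha> k = c * of_real u" "\<beta> k = c * of_real v"
      using real_form_scaled[OF 3[OF k(1)]] .
    have r: "\<alpha> k * of_real (v / u) = \<beta> k" using k(2) cuv by simp
    have "form_integral I \<alpha> \<beta> \<noteq> \<infinity>"
      using form_integral_le[OF card, of \<alpha> \<beta>] by (auto simp: top_unique)
    note form_integral_mean_strict[OF fin card less.prems(2) k(1) r this]
    also have "(\<Sum>k\<in>I. form_integral (I - {k}) \<alpha> \<beta>) \<le> (\<Sum>k\<in>I. ennreal (3 * Beta (1 / 3) (1 / 3)))"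
      by (rule sum_mono) (rule le)
    also have "\<dots> = ennreal (real (card I)) * ennreal (3 * Beta (1 / 3) (1 / 3))"
      by (simp add: ennreal_of_nat_eq_real_of_nat)
    finally show ?thesis
      by (meson mult_left_mono not_le zero_le)
  qed
qed

section \<open>Discriminant and area of a form in terms of the density\<close>

lemma cmod_pair_prod:
  assumes "finite I"
  shows "cmod (pair_prod I \<alpha> \<beta>) = det_prod I \<alpha> \<beta>"
  using assms
proof (induction I rule: finite_induct)
  case empty
  show ?case by (simp add: pair_prod_small det_prod_def)
next
  case (insert k I)
  have "(\<Prod>i\<in>I. cmod (\<alpha> i * \<beta> k - \<beta> i * \<alpha> k)) = (\<Prod>i\<in>I. cmod (\<alpha> k * \<beta> i - \<alpha> i * \<beta> k))"
    by (intro prod.cong refl) (simp add: norm_minus_commute mult.commute)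
  thus ?case
    using insert pair_prod_remove[of "insert k I" k \<alpha> \<beta>] det_prod_remove[of "insert k I" k \<alpha> \<beta>]
    by (simp add: norm_mult norm_power prod_norm[symmetric])
qed

lemma cmod_discriminant:
  assumes "is_factorization n F \<alpha> \<beta>"
  shows "cmod (discriminant n F) = det_prod {..<n} \<alpha> \<beta>"
proof -
  have "{(i, j). i < j \<and> j < n} = {(i, j). i \<in> {..<n} \<and> j \<in> {..<n} \<and> i < j}" by auto
  hence "discriminant n F = pair_prod {..<n} \<alpha> \<beta>"
    using discriminant_eq[OF assms] by (simp add: pair_prod_def)
  thus ?thesis by (simp add: cmod_pair_prod)
qed

lemma normalised_form_area:
  assumes F: "is_factorization n F \<alpha> \<beta>" and "n \<ge> 2" and D: "discriminant n F \<noteq> 0"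
  shows "ennreal (cmod (discriminant n F) powr (1 / (real n * (real n - 1)))) * form_area F =
    form_integral {..<n} \<alpha> \<beta>"
proof -
  define N where "N = (\<lambda>x y :: real. cmod (F (of_real x) (of_real y)))"
  have N: "N x y = (\<Prod>i<n. cmod (\<alpha> i * of_real x - \<beta> i * of_real y))" for x y
    using F by (simp add: N_def is_factorization_def prod_norm)
  have N1: "N t 1 = lin_prod {..<n} \<alpha> \<beta> t" for t
    by (simp add: N lin_prod_def)
  have det: "det_prod {..<n} \<alpha> \<beta> \<noteq> 0"
    using cmod_discriminant[OF F] D by auto
  have "form_area F = (\<integral>\<^sup>+t. ennreal (N t 1 powr (- 2 / real n)) \<partial>lborel)"
  proof -
    have "form_area F = emeasure lborel {(x, y). N x y \<le> 1}"
      by (simp add: form_area_def N_def)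
    also have "\<dots> = (\<integral>\<^sup>+t. ennreal (N t 1 powr (- 2 / real n)) \<partial>lborel)"
    proof (rule homogeneous_area)
    show "(\<lambda>z. N (fst z) (snd z)) \<in> borel_measurable borel"
      unfolding N by measurable
    show "N (s * x) (s * y) = \<bar>s\<bar> ^ n * N x y" for s x y
    proof -
      have "\<alpha> i * of_real (s * x) - \<beta> i * of_real (s * y) = of_real s * (\<alpha> i * of_real x - \<beta> i * of_real y)" for i
        by (simp add: algebra_simps)
      thus ?thesis by (simp only: N norm_mult norm_of_real) (simp add: prod.distrib)
    qed
    show "AE t in lborel. N t 1 \<noteq> 0"
      unfolding N1 using \<open>n \<ge> 2\<close> det by (intro AE_lin_prod_neq_0) auto
    qed (use \<open>n \<ge> 2\<close> in \<open>simp_all add: N_def\<close>)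
    finally show ?thesis .
  qed
  thus ?thesis
    by (simp add: form_integral_def form_density_def cmod_discriminant[OF F] N1 ennreal_mult' nn_integral_cmult)
qed

section \<open>Cubic forms equivalent to XY(X - Y)\<close>

lemma real_form_scale: "real_form (k * of_real u) (k * of_real v)"
  by (simp add: real_form_def)

lemma real_factorization_of_equivalent:
  assumes c: "c \<noteq> 0" and equiv: "GL2R_equivalent (\<lambda>X Y. c * F X Y) (\<lambda>X Y. X * Y * (X - Y))"
  obtains \<alpha> \<beta> where "is_factorization 3 F \<alpha> \<beta>" "\<And>i. real_form (\<alpha> i) (\<beta> i)"
proof -
  obtain T :: "real^2^2" where T: "invertible T"
    and eq: "(\<lambda>X Y. X * Y * (X - Y)) = subst_form (\<lambda>X Y. c * F X Y) T"
    using equiv unfolding GL2R_equivalent_def by blast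
  define p where "p = T $ 1 $ 1"
  define q where "q = T $ 1 $ 2"
  define r where "r = T $ 2 $ 1"
  define s where "s = T $ 2 $ 2"
  define d where "d = p * s - q * r"
  have d: "d \<noteq> 0"
    using T by (simp add: invertible_det_nz det_2 d_def p_def q_def r_def s_def)
  define k where "k = (\<lambda>i :: nat. if i = 0 then 1 / c else 1)"
  \<comment> \<open>The first two pairs (u, - v) are the rows of the inverse of \<open>T\<close>,
    the third their difference. They represent X', Y' and X' - Y', the factors of XY(X - Y) in the
    old coordinates; the scalar 1 / c is absorbed by the first factor.\<close>
  define u where "u = (\<lambda>i :: nat. if i = 0 then s / d else if i = 1 then - r / d else (s + r) / d)"
  define v where "v = (\<lambda>i :: nat. if i = 0 then q / d else if i = 1 then - p / d else (q + p) / d)"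
  have "F X Y = (\<Prod>i<3. k i * of_real (u i) * X - k i * of_real (v i) * Y)" for X Y
  proof -
    define X' where "X' = (of_real s * X - of_real q * Y) / of_real d"
    define Y' where "Y' = (of_real p * Y - of_real r * X) / of_real d"
    have d': "of_real p * of_real s - of_real q * of_real r = (of_real d :: complex)"
      by (simp add: d_def)
    have "of_real p * X' + of_real q * Y' = (of_real p * of_real s - of_real q * of_real r) * X / of_real d"
      "of_real r * X' + of_real s * Y' = (of_real p * of_real s - of_real q * of_real r) * Y / of_real d"
      by (simp_all add: X'_def Y'_def add_divide_distrib[symmetric] algebra_simps)
    hence "of_real p * X' + of_real q * Y' = X" "of_real r * X' + of_real s * Y' = Y"
      unfolding d' using d by simp_all
    moreover have "X' * Y' * (X' - Y') = c * F (of_real p * X' + of_real q * Y') (of_real r * X' + of_real s * Y')"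
      using fun_cong[OF fun_cong[OF eq, of X'], of Y'] by (simp add: subst_form_def p_def q_def r_def s_def)
    ultimately have "F X Y = 1 / c * X' * Y' * (X' - Y')"
      using c by (simp add: field_simps)
    moreover have "X' = of_real (u 0) * X - of_real (v 0) * Y" "Y' = of_real (u 1) * X - of_real (v 1) * Y"
      "X' - Y' = of_real (u 2) * X - of_real (v 2) * Y"
      by (simp_all add: X'_def Y'_def u_def v_def diff_divide_distrib add_divide_distrib algebra_simps)
    ultimately have "F X Y = 1 / c * (of_real (u 0) * X - of_real (v 0) * Y) *
        (of_real (u 1) * X - of_real (v 1) * Y) * (of_real (u 2) * X - of_real (v 2) * Y)"
      by (simp only:)
    also have "\<dots> = (\<Prod>i<3. k i * of_real (u i) * X - k i * of_real (v i) * Y)"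
      by (simp add: numeral_3_eq_3 numeral_2_eq_2 k_def right_diff_distrib[symmetric] mult.assoc)
    finally show ?thesis .
  qed
  hence "is_factorization 3 F (\<lambda>i. k i * of_real (u i)) (\<lambda>i. k i * of_real (v i))"
    by (simp add: is_factorization_def)
  thus ?thesis using that real_form_scale by blast
qed

lemma equivalent_of_real_factorization:
  assumes F: "is_factorization 3 F \<alpha> \<beta>" and real: "\<And>i. i < 3 \<Longrightarrow> real_form (\<alpha> i) (\<beta> i)"
    and det: "det_prod {..<3} \<alpha> \<beta> \<noteq> 0"
  shows "\<exists>c. c \<noteq> 0 \<and> GL2R_equivalent (\<lambda>X Y. c * F X Y) (\<lambda>X Y. X * Y * (X - Y))"
proof -
  obtain k0 and u0 v0 :: real where 0: "\<alpha> 0 = k0 * of_real u0" "\<beta> 0 = k0 * of_real v0"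
    using real_form_scaled[OF real[of 0]] by auto
  obtain k1 and u1 v1 :: real where 1: "\<alpha> 1 = k1 * of_real u1" "\<beta> 1 = k1 * of_real v1"
    using real_form_scaled[OF real[of 1]] by auto
  obtain k2 and u2 v2 :: real where 2: "\<alpha> 2 = k2 * of_real u2" "\<beta> 2 = k2 * of_real v2"
    using real_form_scaled[OF real[of 2]] by auto
  define d01 where "d01 = u0 * v1 - u1 * v0"
  define d02 where "d02 = u0 * v2 - u2 * v0"
  define d12 where "d12 = u1 * v2 - u2 * v1"
  have wedge: "c * of_real u * (c' * of_real v') - c' * of_real u' * (c * of_real v) =
      c * c' * of_real (u * v' - u' * v)" for c c' :: complex and u v u' v' :: real
    by (simp add: algebra_simps)
  have nz: "\<alpha> i * \<beta> j - \<alpha> j * \<beta> i \<noteq> 0" if "i < 3" "j < 3" "i \<noteq> j" for i j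
    using det that by (auto simp: det_prod_neq_0_iff)
  have nz01: "k0 \<noteq> 0" "k1 \<noteq> 0" "d01 \<noteq> 0"
    using nz[of 0 1] unfolding 0 1 wedge d01_def[symmetric] by auto
  have nz02: "k2 \<noteq> 0" "d02 \<noteq> 0"
    using nz[of 0 2] unfolding 0 2 wedge d02_def[symmetric] by auto
  have nz12: "d12 \<noteq> 0"
    using nz[of 1 2] unfolding 1 2 wedge d12_def[symmetric] by auto
  \<comment> \<open>\<open>T\<close> solves L_0 = X / d12 and L_1 = Y / d02 for the real forms. The
    relation d12 L_0 - d02 L_1 + d01 L_2 = 0 then gives L_2 = - (X - Y) / d01, and \<open>c\<close>
    below removes the constants.\<close>
  define T :: "real^2^2" where "T = vector [vector [v1 / (d01 * d12), - v0 / (d01 * d02)],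
    vector [u1 / (d01 * d12), - u0 / (d01 * d02)]]"
  have "det T = - 1 / (d01 * d02 * d12)"
  proof -
    have "det T = - (u0 * v1 - u1 * v0) / (d01 * d01 * d02 * d12)"
      by (simp add: det_2 T_def diff_divide_distrib algebra_simps)
    thus ?thesis using nz01 by (simp add: d01_def[symmetric])
  qed
  hence T: "invertible T" using nz01 nz02 nz12 by (simp add: invertible_det_nz)
  define c where "c = - of_real (d01 * d02 * d12) / (k0 * k1 * k2)"
  have c: "c \<noteq> 0" using nz01 nz02 nz12 by (simp add: c_def)
  have "X * Y * (X - Y) = subst_form (\<lambda>X Y. c * F X Y) T X Y" for X Y
  proof -
    define X' where "X' = of_real (v1 / (d01 * d12)) * X + of_real (- v0 / (d01 * d02)) * Y"
    define Y' where "Y' = of_real (u1 / (d01 * d12)) * X + of_real (- u0 / (d01 * d02)) * Y"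
    have lin: "of_real u * X' - of_real v * Y' =
        of_real ((u * v1 - u1 * v) / (d01 * d12)) * X - of_real ((u * v0 - u0 * v) / (d01 * d02)) * Y" for u v
      by (simp add: X'_def Y'_def diff_divide_distrib algebra_simps)
    have L0: "of_real u0 * X' - of_real v0 * Y' = X / of_real d12"
      unfolding lin using nz01 by (simp add: d01_def[symmetric])
    have L1: "of_real u1 * X' - of_real v1 * Y' = Y / of_real d02"
    proof -
      have "u1 * v0 - u0 * v1 = - d01" by (simp add: d01_def)
      thus ?thesis unfolding lin using nz01 by simp
    qed
    have L2: "of_real u2 * X' - of_real v2 * Y' = - (X - Y) / of_real d01"
    proof -
      have "u2 * v1 - u1 * v2 = - d12" "u2 * v0 - u0 * v2 = - d02" by (simp_all add: d12_def d02_def)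
      thus ?thesis unfolding lin using nz12 nz02 by (simp add: diff_divide_distrib)
    qed
    have "F X' Y' = k0 * k1 * k2 * ((of_real u0 * X' - of_real v0 * Y') *
        (of_real u1 * X' - of_real v1 * Y') * (of_real u2 * X' - of_real v2 * Y'))"
      using F by (simp add: is_factorization_def numeral_3_eq_3)
        (simp add: 0 1[simplified] 2[unfolded numeral_2_eq_2] algebra_simps)
    hence "c * F X' Y' = X * Y * (X - Y)"
      unfolding L0 L1 L2 using nz01 nz02 nz12 by (simp add: c_def field_simps)
    thus ?thesis by (simp add: subst_form_def T_def X'_def Y'_def)
  qed
  hence "GL2R_equivalent (\<lambda>X Y. c * F X Y) (\<lambda>X Y. X * Y * (X - Y))"
    unfolding GL2R_equivalent_def using T by blast
  thus ?thesis using c by blast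
qed

theorem theorem2:
  fixes n :: nat and F :: "complex \<Rightarrow> complex \<Rightarrow> complex"
  assumes "n \<ge> 3"
    and "binary_form n F"
    and "discriminant n F \<noteq> 0"
  shows "ennreal (cmod (discriminant n F) powr (1 / (real n * (real n - 1)))) * form_area F
           \<le> ennreal (3 * Beta (1 / 3) (1 / 3)) \<and>
         (ennreal (cmod (discriminant n F) powr (1 / (real n * (real n - 1)))) * form_area F
           = ennreal (3 * Beta (1 / 3) (1 / 3)) \<longleftrightarrow>
          n = 3 \<and> (\<exists>c :: complex. c \<noteq> 0 \<and>
            GL2R_equivalent (\<lambda>X Y. c * F X Y) (\<lambda>X Y. X * Y * (X - Y))))"
proof -
  have n2: "n \<ge> 2" using assms(1) by simp
  obtain \<alpha> \<beta> where F: "is_factorization n F \<alpha> \<beta>"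
    using binary_form_factorization[OF assms(2)] assms(1) by auto
  have det: "det_prod {..<n} \<alpha> \<beta> \<noteq> 0"
    using cmod_discriminant[OF F] assms(3) by auto
  note area = normalised_form_area[OF _ n2 assms(3)]
  have eq: "form_integral {..<n} \<alpha> \<beta> = ennreal (3 * Beta (1 / 3) (1 / 3)) \<longleftrightarrow>
      n = 3 \<and> (\<exists>c. c \<noteq> 0 \<and> GL2R_equivalent (\<lambda>X Y. c * F X Y) (\<lambda>X Y. X * Y * (X - Y)))"
  proof (intro iffI conjI)
    assume K: "form_integral {..<n} \<alpha> \<beta> = ennreal (3 * Beta (1 / 3) (1 / 3))"
    show n: "n = 3"
    proof (rule ccontr)
      assume "n \<noteq> 3"
      hence "card {..<n} \<ge> 4" using assms(1) by simp
      from form_integral_less[OF this det] show False using K by simp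
    qed
    have "real_form (\<alpha> i) (\<beta> i)" if "i < 3" for i
    proof (rule ccontr)
      assume "\<not> real_form (\<alpha> i) (\<beta> i)"
      from cubic_form_integral_less[OF _ _ this det] show False using K n that by simp
    qed
    thus "\<exists>c. c \<noteq> 0 \<and> GL2R_equivalent (\<lambda>X Y. c * F X Y) (\<lambda>X Y. X * Y * (X - Y))"
      using equivalent_of_real_factorization F det n by blast
  next
    assume "n = 3 \<and> (\<exists>c. c \<noteq> 0 \<and> GL2R_equivalent (\<lambda>X Y. c * F X Y) (\<lambda>X Y. X * Y * (X - Y)))"
    then obtain c where n: "n = 3" and "c \<noteq> 0"
      "GL2R_equivalent (\<lambda>X Y. c * F X Y) (\<lambda>X Y. X * Y * (X - Y))" by blast
    then obtain \<gamma> \<delta> where G: "is_factorization n F \<gamma> \<delta>" and real: "\<And>i. real_form (\<gamma> i) (\<delta> i)"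
      using real_factorization_of_equivalent by metis
    have "det_prod {..<n} \<gamma> \<delta> \<noteq> 0"
      using cmod_discriminant[OF G] assms(3) by auto
    hence "form_integral {..<n} \<gamma> \<delta> = ennreal (3 * Beta (1 / 3) (1 / 3))"
      using n real by (intro cubic_form_integral_real) auto
    \<comment> \<open>The real factorization need not be the one chosen at the start; both integrals
      equal the normalised area of \<open>F\<close>.\<close>
    thus "form_integral {..<n} \<alpha> \<beta> = ennreal (3 * Beta (1 / 3) (1 / 3))"
      using area[OF F] area[OF G] by simp
  qed
  show ?thesis
    unfolding area[OF F] eq using form_integral_le[of "{..<n}" \<alpha> \<beta>] assms(1) by simp
qed

end
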